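(* Let $1\le p<\infty$. There is a constant $K_3>0$, independent of $f$ and $n$, such that $\|g-B_n(g)\|_p\le K_3\,n^{-1}\|g''\|_p$ for all $g\in W^2_p([0,1])$ and $n\in\mathbb{N}$ and such that, with $C_1=K_3+1$, for every $f\in L^p([0,1])$ and every $n\in\mathbb{N}$ with $n\ge4$, $$\|f-B_n(f)\|_p\le\|\tilde f_{\frac1{\sqrt n},2}-f\|_{\ell_p(X_n)}+C_1\,\omega_2(f,1/\sqrt n)_p.$$ In particular, $$\|f-B_n(f)\|_p\le C_1\,\tilde\Omega_{2,2}\left(f,\tfrac1{\sqrt n},X_n\right)_p.$$
   Context: Bernstein polynomials on $[0,1]$: $B_nf(x)=\sum_{k=0}^nf\big(\frac kn\big)\binom nkx^k(1-x)^{n-k}$, and $X_n=(k/n)_{k=0}^n$. Conventions: $L^p([0,1])$ consists of pointwise defined functions (functions equal almost everywhere are not identified); $\|\cdot\|_p$ is the $L^p([0,1])$ norm. $W^2_p([0,1])$ is the usual Sobolev space, whose elements are taken as functions $g$ with $g,g'$ absolutely continuous on $[0,1]$ and $g''\in L^p([0,1])$. Discrete semi-norm: $\|f\|_{\ell_p(X_n)}=\big(\frac1n\sum_{k=0}^n|f(k/n)|^p\big)^{1/p}$. Modulus of smoothness: $\omega_2(f,\delta)_p=\sup_{0<h\le\delta}\big(\int_0^{1-2h}|f(x)-2f(x+h)+f(x+2h)|^p\,dx\big)^{1/p}$ (the integral is $0$ if $2h\ge1$). Steklov averages, for $0<\delta\le1/2$: $\tilde f_{\delta,2}(x)=\delta^{-2}\int_0^\delta\int_0^\delta\sum_{m=1}^2(-1)^{3-m}\binom2{2-m}f(x+m\theta_x)\,dt_1dt_2$,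 with $\theta_x=\frac{t_1+t_2}2-x\delta$. Semi-discrete modulus with step $1/\sqrt n$: $\tilde\Omega_{2,2}(f,\frac1{\sqrt n},X_n)_p=\|\tilde f_{1/\sqrt n,2}-f\|_{\ell_p(X_n)}+\omega_2(f,1/\sqrt n)_p$. *)

theory Defs
  imports "HOL-Analysis.Analysis"
begin

definition bernstein_op :: "nat \<Rightarrow> (real \<Rightarrow> real) \<Rightarrow> real \<Rightarrow> real" where
  "bernstein_op n f x = (\<Sum>k\<le>n. f (real k / real n) * Bernstein n k x)"

text \<open>A function on \<open>[0,1]\<close> is a total function whose values outside \<open>[0,1]\<close> are irrelevant;
  all measure-theoretic notions refer to Lebesgue (not only Borel) measurability.\<close>

definition Lp_set :: "real \<Rightarrow> real set \<Rightarrow> (real \<Rightarrow> real) set" where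
  "Lp_set p S = {f \<in> borel_measurable (lebesgue_on S).
     integrable (lebesgue_on S) (\<lambda>x. \<bar>f x\<bar> powr p)}"

definition Lp_norm :: "real \<Rightarrow> real set \<Rightarrow> (real \<Rightarrow> real) \<Rightarrow> real" where
  "Lp_norm p S f = (LINT x|lebesgue_on S. \<bar>f x\<bar> powr p) powr (1 / p)"

text \<open>The standard \<open>\<epsilon>\<close>-\<open>\<delta>\<close> definition (HOL-Analysis only has absolute continuity of measures);
  \<open>\<D>\<close> ranges over the finite families of non-overlapping compact intervals \<open>[Inf I, Sup I]\<close>
  contained in \<open>S\<close>.\<close>

definition abs_continuous_on :: "real set \<Rightarrow> (real \<Rightarrow> real) \<Rightarrow> bool" where
  "abs_continuous_on S f \<longleftrightarrow> (\<forall>\<epsilon>>0. \<exists>\<delta>>0. \<forall>\<D>. \<D> division_of \<Union>\<D> \<and> \<Union>\<D> \<subseteq> S \<and>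
     (\<Sum>I\<in>\<D>. (Sup I - Inf I)) < \<delta> \<longrightarrow> (\<Sum>I\<in>\<D>. \<bar>f (Sup I) - f (Inf I)\<bar>) < \<epsilon>)"

text \<open>The derivative on \<open>[0,1]\<close>, one-sided at the end points. It is an unspecified value where the
  derivative does not exist; for \<open>g''\<close> below this concerns only a null set.\<close>

definition deriv01 :: "(real \<Rightarrow> real) \<Rightarrow> real \<Rightarrow> real" where
  "deriv01 g x = vector_derivative g (at x within {0..1})"

text \<open>The almost-everywhere differentiability of \<open>g'\<close> is a consequence of its absolute continuity
  (Lebesgue); it is spelled out as part of what it means for \<open>g''\<close> to be an \<open>L\<^sup>p\<close> function.\<close>

definition sobolev_W2 :: "real \<Rightarrow> (real \<Rightarrow> real) set" where
  "sobolev_W2 p = {g. abs_continuous_on {0..1} g \<and>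
     (\<forall>x\<in>{0..1}. g differentiable (at x within {0..1})) \<and>
     abs_continuous_on {0..1} (deriv01 g) \<and>
     (AE x in lebesgue_on {0..1}. deriv01 g differentiable (at x within {0..1})) \<and>
     deriv01 (deriv01 g) \<in> Lp_set p {0..1}}"

definition disc_seminorm :: "real \<Rightarrow> nat \<Rightarrow> (real \<Rightarrow> real) \<Rightarrow> real" where
  "disc_seminorm p n f = (1 / real n * (\<Sum>k\<le>n. \<bar>f (real k / real n)\<bar> powr p)) powr (1 / p)"

text \<open>For \<open>2 * h \<ge> 1\<close> the interval is empty or a point and the integral is \<open>0\<close>. For \<open>f\<close> in
  \<open>L\<^sup>p([0,1])\<close> the supremum is over a set bounded by \<open>4 * Lp_norm p {0..1} f\<close>, hence genuine.\<close>

definition omega2 :: "real \<Rightarrow> (real \<Rightarrow> real) \<Rightarrow> real \<Rightarrow> real" where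
  "omega2 p f \<delta> =
     (SUP h\<in>{0<..\<delta>}. Lp_norm p {0..1 - 2 * h} (\<lambda>x. f x - 2 * f (x + h) + f (x + 2 * h)))"

definition steklov2 :: "real \<Rightarrow> (real \<Rightarrow> real) \<Rightarrow> real \<Rightarrow> real" where
  "steklov2 \<delta> f x = 1 / \<delta>\<^sup>2 *
     (LINT t\<^sub>1:{0..\<delta>}|lebesgue. (LINT t\<^sub>2:{0..\<delta>}|lebesgue.
        (\<Sum>m=1..2. (-1) ^ (3 - m) * real (2 choose (2 - m)) *
           f (x + real m * ((t\<^sub>1 + t\<^sub>2) / 2 - x * \<delta>)))))"

definition Omega22 :: "real \<Rightarrow> (real \<Rightarrow> real) \<Rightarrow> real \<Rightarrow> nat \<Rightarrow> real" where
  "Omega22 p f \<delta> n = disc_seminorm p n (\<lambda>x. steklov2 \<delta> f x - f x) + omega2 p f \<delta>"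

end

theory Submission
  imports Defs
begin

text \<open>
  With \<open>\<delta> = 1 / sqrt n\<close> and \<open>T\<close> the Steklov average of \<open>f\<close>, the error splits as
  \<open>f - B\<^sub>n f = (f - T) + (T - B\<^sub>n T) + B\<^sub>n (T - f)\<close>, and Minkowski's inequality
  (\<open>Lp_bounded_add\<close>) adds the norms of the three terms. Write \<open>\<omega>\<close> for \<open>\<omega>\<^sub>2(f, \<delta>)\<^sub>p\<close>.

  The last term depends only on values at the nodes. Jensen's inequality for the weights
  \<open>Bernstein n k x\<close>, which have integral \<open>1 / (n + 1)\<close>, bounds its norm by the discrete seminorm
  with constant \<open>1\<close> (\<open>bernstein_op_Lp_bounded\<close>).

  The first term is at \<open>x\<close> an average of second differences \<open>\<Delta>\<^sub>\<theta> f x\<close> over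
  \<open>\<theta> \<in> [- x \<delta>, (1 - x) \<delta>]\<close>, steps for which \<open>x + 2 \<theta>\<close> stays in \<open>[0,1]\<close>. Jensen's inequality and
  Tonelli's theorem reduce its \<open>p\<close>-th power to the integrals that define \<open>\<omega>\<close>, one for every
  \<open>\<theta>\<close>, and give \<open>4 \<omega>\<close> (\<open>steklov_deviation_Lp_bounded\<close>).

  For the middle term, let \<open>g x = a + b x + \<integral> max 0 (x - u) h(u) du\<close>, so that \<open>h = g''\<close>. Since \<open>B\<^sub>n\<close>
  reproduces affine functions, \<open>B\<^sub>n g x - g x = \<integral> K(x,u) h(u) du\<close>, where \<open>K(x,u)\<close> is the error of
  \<open>B\<^sub>n\<close> on the hinge function \<open>t \<mapsto> max 0 (t - u)\<close>. Hinges are convex, so \<open>K \<ge> 0\<close>, and both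
  \<open>\<integral> K(x,u) du\<close> and \<open>\<integral> K(x,u) dx\<close> are at most \<open>1 / n\<close>. Schur's test then gives
  \<open>\<parallel>g - B\<^sub>n g\<parallel> \<le> \<parallel>h\<parallel> / n\<close> for all \<open>p \<ge> 1\<close> at once (\<open>bernstein_approx_prim2\<close>). Functions in
  \<open>W\<^sup>2\<^sub>p\<close> have this form by the fundamental theorem of calculus for absolutely continuous functions
  (\<open>sobolev_W2_representation\<close>). So has \<open>T\<close>, which is built from second differences of a second
  antiderivative of \<open>f\<close>; its density is a combination of second differences of \<open>f\<close> itself,
  of norm at most \<open>9 n \<omega>\<close> (\<open>steklov_borel_representation\<close>, \<open>steklov_density_Lp_bounded\<close>).

  Together these give \<open>13 \<omega>\<close> next to the discrete seminorm, and \<open>K\<^sub>3 = 12\<close> works.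

  The measure theory is done for Borel functions on the line that vanish outside \<open>[0,1]\<close>, with
  Lebesgue-Borel measure, because that makes Tonelli's theorem directly applicable. The Steklov
  average and the norms do not change when \<open>f\<close> is replaced by such a representative; the node
  values of \<open>f\<close>, which do change, enter only through \<open>B\<^sub>n (T - f)\<close>.
\<close>

section \<open>Jensen, Schur and Minkowski inequalities\<close>

lemma powr_tangent_le:
  fixes r p :: real
  assumes "0 \<le> r" "1 \<le> p"
  shows "1 + p * (r - 1) \<le> r powr p"
proof (cases "r = 0")
  case False
  have "(r powr p) powr (1/p) * 1 powr (1 - 1/p) \<le> (1/p) * (r powr p) + (1 - 1/p) * 1"
    by (rule Youngs_inequality_0) (use assms False in auto)
  then have "r \<le> (1/p) * (r powr p) + (1 - 1/p)"
    using assms False by (simp add: powr_powr)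
  then have "p * r \<le> p * ((1/p) * (r powr p) + (1 - 1/p))"
    using assms by (intro mult_left_mono) auto
  also have "\<dots> = r powr p + p - 1"
    using assms by (simp add: field_simps)
  finally show ?thesis
    by (simp add: algebra_simps)
qed (use assms in auto)

text \<open>Convexity of \<open>t powr p\<close> as a supporting line at \<open>c\<close>. Jensen's and Minkowski's
  inequalities below both follow by averaging it over a well-chosen \<open>c\<close>.\<close>

lemma powr_tangent:
  fixes t c p :: real
  assumes "0 \<le> t" "0 < c" "1 \<le> p"
  shows "c powr p + p * c powr (p - 1) * (t - c) \<le> t powr p"
proof -
  have "c powr p * (1 + p * (t / c - 1)) \<le> c powr p * (t / c) powr p"
    using assms by (intro mult_left_mono powr_tangent_le) auto
  also have "\<dots> = t powr p"
    using assms by (simp add: powr_divide)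
  finally show ?thesis
    using assms by (simp add: field_simps powr_diff)
qed

lemma abs_le_one_plus_powr:
  fixes a p :: real
  assumes "1 \<le> p"
  shows "\<bar>a\<bar> \<le> 1 + \<bar>a\<bar> powr p"
proof (cases "\<bar>a\<bar> \<le> 1")
  case True
  then show ?thesis by (smt (verit) powr_ge_zero)
next
  case False
  then have "\<bar>a\<bar> powr 1 \<le> \<bar>a\<bar> powr p"
    using assms by (intro powr_mono) auto
  then show ?thesis using False by simp
qed

text \<open>Average the tangent of \<open>t powr p\<close> at \<open>c = (\<integral> k \<bar>h\<bar>) / C\<close> against \<open>k\<close>. It is
  stated for an upper bound \<open>C\<close> of the mass, so that it serves probability weights as well as the
  kernels of Schur's test, and with the nonnegative integral on the right, so that its users
  need not check integrability.\<close>

lemma kernel_jensen: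
  fixes k h :: "'a \<Rightarrow> real"
  assumes p: "1 \<le> p" and C: "0 < C"
    and [measurable]: "k \<in> borel_measurable M" "h \<in> borel_measurable M"
    and k: "\<And>x. x \<in> space M \<Longrightarrow> 0 \<le> k x" and kC: "(\<integral>\<^sup>+x. ennreal (k x) \<partial>M) \<le> ennreal C"
  shows "ennreal (\<bar>\<integral>x. k x * h x \<partial>M\<bar> powr p)
    \<le> ennreal (C powr (p - 1)) * (\<integral>\<^sup>+x. ennreal (k x * \<bar>h x\<bar> powr p) \<partial>M)"
proof (cases "(\<integral>\<^sup>+x. ennreal (k x * \<bar>h x\<bar> powr p) \<partial>M) = \<infinity>")
  case True
  then show ?thesis
    using C by (simp add: ennreal_mult_top)
next
  case False
  have AEk: "AE x in M. 0 \<le> k x" by (auto intro: k)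
  have ik: "integrable M k"
    using kC by (intro integrableI_nonneg AEk) (auto simp: top.not_eq_extremum intro: le_less_trans)
  have ikh: "integrable M (\<lambda>x. k x * \<bar>h x\<bar> powr p)"
    using False by (intro integrableI_nonneg) (auto simp: top.not_eq_extremum k)
  have iabs: "integrable M (\<lambda>x. k x * \<bar>h x\<bar>)"
  proof (rule Bochner_Integration.integrable_bound[OF Bochner_Integration.integrable_add[OF ik ikh]])
    show "AE x in M. norm (k x * \<bar>h x\<bar>) \<le> norm (k x + k x * \<bar>h x\<bar> powr p)"
    proof (rule AE_I2)
      fix x assume x: "x \<in> space M"
      have "\<bar>h x\<bar> \<le> 1 + \<bar>h x\<bar> powr p"
        by (rule abs_le_one_plus_powr[OF p])
      then have "k x * \<bar>h x\<bar> \<le> k x * (1 + \<bar>h x\<bar> powr p)"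
        using k[OF x] by (rule mult_left_mono)
      then show "norm (k x * \<bar>h x\<bar>) \<le> norm (k x + k x * \<bar>h x\<bar> powr p)"
        using k[OF x] by (simp add: algebra_simps)
    qed
  qed measurable
  define A where "A = (\<integral>x. k x * \<bar>h x\<bar> \<partial>M)"
  define c where "c = A / C"
  have A0: "0 \<le> A"
    unfolding A_def by (intro integral_nonneg_AE AE_I2) (simp add: k)
  have kC': "(\<integral>x. k x \<partial>M) \<le> C"
    using kC C AEk ik by (subst (asm) nn_integral_eq_integral) auto
  have "\<bar>\<integral>x. k x * h x \<partial>M\<bar> \<le> (\<integral>x. \<bar>k x * h x\<bar> \<partial>M)"
    by (rule integral_abs_bound)
  also have "\<dots> = A"
    unfolding A_def by (intro Bochner_Integration.integral_cong) (auto simp: abs_mult k)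
  finally have "\<bar>\<integral>x. k x * h x \<partial>M\<bar> powr p \<le> A powr p"
    using p by (intro powr_mono2) auto
  also have "A powr p \<le> C powr (p - 1) * (\<integral>x. k x * \<bar>h x\<bar> powr p \<partial>M)"
  proof (cases "A = 0")
    case True
    have "0 \<le> (\<integral>x. k x * \<bar>h x\<bar> powr p \<partial>M)"
      by (intro integral_nonneg_AE AE_I2) (simp add: k)
    then show ?thesis using True p by simp
  next
    case False
    then have c: "0 < c" using A0 C by (simp add: c_def)
    have "(\<integral>x. (c powr p - p * c powr p) * k x + (p * c powr (p - 1)) * (k x * \<bar>h x\<bar>) \<partial>M)
        \<le> (\<integral>x. k x * \<bar>h x\<bar> powr p \<partial>M)"
    proof (intro integral_mono)
      fix x assume x: "x \<in> space M"
      have le: "k x * (c powr p + p * c powr (p - 1) * (\<bar>h x\<bar> - c)) \<le> k x * \<bar>h x\<bar> powr p"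
        using k[OF x] c p by (intro mult_left_mono powr_tangent) auto
      have eq: "c powr p + p * c powr (p - 1) * (\<bar>h x\<bar> - c)
          = (c powr p - p * c powr p) + p * c powr (p - 1) * \<bar>h x\<bar>"
      proof -
        have "c powr (p - 1) * c = c powr p"
          using c by (simp add: powr_diff)
        moreover have "p * c powr (p - 1) * (\<bar>h x\<bar> - c)
            = p * c powr (p - 1) * \<bar>h x\<bar> - p * (c powr (p - 1) * c)"
          by (simp only: right_diff_distrib mult.assoc)
        ultimately show ?thesis by simp
      qed
      show "(c powr p - p * c powr p) * k x + (p * c powr (p - 1)) * (k x * \<bar>h x\<bar>)
         \<le> k x * \<bar>h x\<bar> powr p"
        using le unfolding eq
        by (simp add: algebra_simps)
    qed (use ik iabs ikh in auto)
    also have "(\<integral>x. (c powr p - p * c powr p) * k x + (p * c powr (p - 1)) * (k x * \<bar>h x\<bar>) \<partial>M)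
        = (c powr p - p * c powr p) * (\<integral>x. k x \<partial>M) + p * c powr (p - 1) * A"
      using ik iabs by (simp add: A_def)
    also have "p * c powr (p - 1) * A = p * (c powr p * C)"
      using c C by (simp add: c_def powr_diff field_simps)
    finally have "(c powr p - p * c powr p) * (\<integral>x. k x \<partial>M) + p * (c powr p * C)
        \<le> (\<integral>x. k x * \<bar>h x\<bar> powr p \<partial>M)" .
    moreover have "(p - 1) * c powr p * (\<integral>x. k x \<partial>M) \<le> (p - 1) * c powr p * C"
      using p kC' by (intro mult_left_mono) auto
    ultimately have "c powr p * C \<le> (\<integral>x. k x * \<bar>h x\<bar> powr p \<partial>M)"
      by (simp add: algebra_simps)
    then have "C powr (p - 1) * (c powr p * C) \<le> C powr (p - 1) * (\<integral>x. k x * \<bar>h x\<bar> powr p \<partial>M)"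
      by (intro mult_left_mono) auto
    moreover have "C powr (p - 1) * (c powr p * C) = A powr p"
      using C A0 by (simp add: c_def powr_diff powr_divide)
    ultimately show ?thesis by simp
  qed
  finally have "ennreal (\<bar>\<integral>x. k x * h x \<partial>M\<bar> powr p)
     \<le> ennreal (C powr (p - 1) * (\<integral>x. k x * \<bar>h x\<bar> powr p \<partial>M))"
    by (rule ennreal_leI)
  also have "\<dots> = ennreal (C powr (p - 1)) * (\<integral>\<^sup>+x. ennreal (k x * \<bar>h x\<bar> powr p) \<partial>M)"
    using ikh k by (subst nn_integral_eq_integral)
      (auto intro!: ennreal_mult integral_nonneg_AE)
  finally show ?thesis .
qed

text \<open>Jensen in each row, then Tonelli, then the column bound. Row and column masses bounded by
  the same \<open>C\<close> give operator norm at most \<open>C\<close> for every exponent \<open>p\<close>, including \<open>p = 1\<close>.\<close>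

lemma schur_test:
  fixes k :: "'a \<Rightarrow> 'b \<Rightarrow> real"
  assumes "sigma_finite_measure M" "sigma_finite_measure N"
    and p: "1 \<le> p" and C: "0 < C"
    and [measurable]: "(\<lambda>(x, y). k x y) \<in> borel_measurable (M \<Otimes>\<^sub>M N)" "h \<in> borel_measurable N"
    and k: "\<And>x y. x \<in> space M \<Longrightarrow> y \<in> space N \<Longrightarrow> 0 \<le> k x y"
    and row: "\<And>x. x \<in> space M \<Longrightarrow> (\<integral>\<^sup>+y. ennreal (k x y) \<partial>N) \<le> ennreal C"
    and col: "\<And>y. y \<in> space N \<Longrightarrow> (\<integral>\<^sup>+x. ennreal (k x y) \<partial>M) \<le> ennreal C"
  shows "(\<integral>\<^sup>+x. ennreal (\<bar>\<integral>y. k x y * h y \<partial>N\<bar> powr p) \<partial>M)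
    \<le> ennreal (C powr p) * (\<integral>\<^sup>+y. ennreal (\<bar>h y\<bar> powr p) \<partial>N)"
proof -
  interpret pair_sigma_finite M N using assms(1,2) by (simp add: pair_sigma_finite_def)
  have "(\<integral>\<^sup>+x. ennreal (\<bar>\<integral>y. k x y * h y \<partial>N\<bar> powr p) \<partial>M)
    \<le> (\<integral>\<^sup>+x. ennreal (C powr (p - 1)) * (\<integral>\<^sup>+y. ennreal (k x y * \<bar>h y\<bar> powr p) \<partial>N) \<partial>M)"
    by (intro nn_integral_mono kernel_jensen p C row) (auto simp: k)
  also have "\<dots> = ennreal (C powr (p - 1)) * (\<integral>\<^sup>+x. \<integral>\<^sup>+y. ennreal (k x y * \<bar>h y\<bar> powr p) \<partial>N \<partial>M)"
    by (intro nn_integral_cmult) measurable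
  also have "(\<integral>\<^sup>+x. \<integral>\<^sup>+y. ennreal (k x y * \<bar>h y\<bar> powr p) \<partial>N \<partial>M)
      = (\<integral>\<^sup>+y. \<integral>\<^sup>+x. ennreal (k x y * \<bar>h y\<bar> powr p) \<partial>M \<partial>N)"
    by (rule Fubini'[symmetric]) measurable
  also have "\<dots> = (\<integral>\<^sup>+y. (\<integral>\<^sup>+x. ennreal (k x y) \<partial>M) * ennreal (\<bar>h y\<bar> powr p) \<partial>N)"
    by (intro nn_integral_cong)
       (simp add: k ennreal_mult flip: nn_integral_multc cong: nn_integral_cong)
  also have "\<dots> \<le> (\<integral>\<^sup>+y. ennreal C * ennreal (\<bar>h y\<bar> powr p) \<partial>N)"
    by (intro nn_integral_mono mult_right_mono col) auto
  also have "\<dots> = ennreal C * (\<integral>\<^sup>+y. ennreal (\<bar>h y\<bar> powr p) \<partial>N)"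
    by (intro nn_integral_cmult) measurable
  also have "ennreal (C powr (p - 1)) * (ennreal C * (\<integral>\<^sup>+y. ennreal (\<bar>h y\<bar> powr p) \<partial>N))
      = ennreal (C powr p) * (\<integral>\<^sup>+y. ennreal (\<bar>h y\<bar> powr p) \<partial>N)"
    using C by (simp add: powr_diff flip: mult.assoc ennreal_mult)
  finally show ?thesis
    by (simp add: mult_left_mono)
qed

text \<open>Bounds on the \<open>L\<^sup>p\<close> norm, phrased with the nonnegative integral: unlike an inequality for
  \<open>Lp_norm\<close>, which is \<open>0\<close> on functions that are not \<open>p\<close>-integrable, they include integrability.\<close>

definition Lp_bounded :: "real \<Rightarrow> real set \<Rightarrow> (real \<Rightarrow> real) \<Rightarrow> real \<Rightarrow> bool" where
  "Lp_bounded p S f A \<longleftrightarrow> (\<integral>\<^sup>+x\<in>S. ennreal (\<bar>f x\<bar> powr p) \<partial>lborel) \<le> ennreal (A powr p)"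

lemma Lp_bounded_mono:
  assumes "Lp_bounded p S f A" "A \<le> B" "0 \<le> A" "0 \<le> p"
  shows "Lp_bounded p S f B"
  using assms unfolding Lp_bounded_def
  by (meson ennreal_leI order_trans powr_mono2)

lemma Lp_bounded_le_AE:
  assumes "Lp_bounded p S f A" "AE x in lborel. x \<in> S \<longrightarrow> \<bar>g x\<bar> \<le> \<bar>f x\<bar>" "0 \<le> p"
  shows "Lp_bounded p S g A"
proof -
  have "(\<integral>\<^sup>+x\<in>S. ennreal (\<bar>g x\<bar> powr p) \<partial>lborel) \<le> (\<integral>\<^sup>+x\<in>S. ennreal (\<bar>f x\<bar> powr p) \<partial>lborel)"
    using assms(2)
    by (intro nn_integral_mono_AE) (auto elim!: eventually_mono intro!: ennreal_leI powr_mono2 simp: assms(3) split: split_indicator)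
  with assms(1) show ?thesis unfolding Lp_bounded_def by order
qed

lemma Lp_bounded_cmult:
  assumes "Lp_bounded p S f A" "0 \<le> A" and [measurable]: "f \<in> borel_measurable borel" "S \<in> sets borel"
  shows "Lp_bounded p S (\<lambda>x. c * f x) (\<bar>c\<bar> * A)"
proof -
  have "(\<integral>\<^sup>+x\<in>S. ennreal (\<bar>c * f x\<bar> powr p) \<partial>lborel)
      = (\<integral>\<^sup>+x. ennreal (\<bar>c\<bar> powr p) * (ennreal (\<bar>f x\<bar> powr p) * indicator S x) \<partial>lborel)"
    by (intro nn_integral_cong) (auto simp: abs_mult powr_mult ennreal_mult split: split_indicator)
  also have "\<dots> = ennreal (\<bar>c\<bar> powr p) * (\<integral>\<^sup>+x\<in>S. ennreal (\<bar>f x\<bar> powr p) \<partial>lborel)"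
    by (rule nn_integral_cmult) measurable
  also have "\<dots> \<le> ennreal (\<bar>c\<bar> powr p) * ennreal (A powr p)"
    using assms(1) by (intro mult_left_mono) (auto simp: Lp_bounded_def)
  also have "\<dots> = ennreal ((\<bar>c\<bar> * A) powr p)"
    using assms(2) by (simp add: powr_mult ennreal_mult)
  finally show ?thesis by (simp add: Lp_bounded_def)
qed

text \<open>This allows Minkowski's inequality to be proved for strictly positive bounds, by which one
  can divide.\<close>

lemma Lp_bounded_limit:
  assumes "\<And>e. 0 < e \<Longrightarrow> Lp_bounded p S f (A + e)" "0 \<le> A" "0 < p"
  shows "Lp_bounded p S f A"
  unfolding Lp_bounded_def
proof (rule tendsto_lowerbound)
  show "((\<lambda>e. ennreal ((A + e) powr p)) \<longlongrightarrow> ennreal (A powr p)) (at_right 0)"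
  proof (rule tendsto_ennrealI)
    have "((\<lambda>e. (A + e) powr p) \<longlongrightarrow> (A + 0) powr p) (at_right 0)"
    proof (rule tendsto_powr2)
      show "\<forall>\<^sub>F e in at_right 0. 0 \<le> A + e"
        using assms(2) by (auto simp: eventually_at_right_field intro!: exI[of _ 1])
      show "((\<lambda>e. A + e) \<longlongrightarrow> A + 0) (at_right 0)"
        by (intro tendsto_add tendsto_const tendsto_ident_at)
    qed (simp_all add: assms)
    then show "((\<lambda>e. (A + e) powr p) \<longlongrightarrow> A powr p) (at_right 0)" by simp
  qed
  show "\<forall>\<^sub>F e in at_right 0. (\<integral>\<^sup>+x\<in>S. ennreal (\<bar>f x\<bar> powr p) \<partial>lborel) \<le> ennreal ((A + e) powr p)"
    using assms(1) by (auto simp: Lp_bounded_def eventually_at_right_field intro!: exI[of _ 1])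
qed simp

text \<open>Minkowski's inequality: \<open>u + v\<close> is, up to the factor \<open>a + b\<close>, the convex combination of
  \<open>u / a\<close> and \<open>v / b\<close> with weights \<open>a / (a + b)\<close> and \<open>b / (a + b)\<close>.\<close>

lemma Lp_bounded_add:
  assumes p: "1 \<le> p" and f: "Lp_bounded p S f A" and g: "Lp_bounded p S g B" and A: "0 \<le> A" and B: "0 \<le> B"
    and [measurable]: "f \<in> borel_measurable borel" "g \<in> borel_measurable borel" "S \<in> sets borel"
  shows "Lp_bounded p S (\<lambda>x. f x + g x) (A + B)"
proof (rule Lp_bounded_limit)
  fix e :: real assume e: "0 < e"
  define a b where "a = A + e / 2" and "b = B + e / 2"
  have ab: "0 < a" "0 < b" "a + b = A + B + e" using A B e by (auto simp: a_def b_def field_simps)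
  have fa: "Lp_bounded p S f a" by (rule Lp_bounded_mono[OF f]) (use A e p in \<open>auto simp: a_def\<close>)
  have gb: "Lp_bounded p S g b" by (rule Lp_bounded_mono[OF g]) (use B e p in \<open>auto simp: b_def\<close>)
  have conv: "\<bar>u + v\<bar> powr p \<le> (a + b) powr (p - 1) * (a powr (1 - p) * \<bar>u\<bar> powr p + b powr (1 - p) * \<bar>v\<bar> powr p)"
    for u v :: real
  proof -
    \<comment> \<open>the weighted mean of \<open>\<bar>u\<bar> / a\<close> and \<open>\<bar>v\<bar> / b\<close>, at which the linear terms of the two tangents cancel\<close>
    define s where "s = (\<bar>u\<bar> + \<bar>v\<bar>) / (a + b)"
    show ?thesis
    proof (cases "s = 0")
      case True
      then have "u = 0" "v = 0" using ab by (auto simp: s_def)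
      then show ?thesis using p by simp
    next
      case False
      then have s: "0 < s" using ab by (simp add: s_def order_less_le)
      have 1: "s powr p + p * s powr (p - 1) * (\<bar>u\<bar> / a - s) \<le> (\<bar>u\<bar> / a) powr p"
        by (rule powr_tangent) (use ab s p in auto)
      have 2: "s powr p + p * s powr (p - 1) * (\<bar>v\<bar> / b - s) \<le> (\<bar>v\<bar> / b) powr p"
        by (rule powr_tangent) (use ab s p in auto)
      have "(a + b) * s = \<bar>u\<bar> + \<bar>v\<bar>"
        using ab(1,2) by (simp add: s_def)
      then have "a * (\<bar>u\<bar> / a - s) + b * (\<bar>v\<bar> / b - s) = 0"
        using ab(1,2) by (simp add: algebra_simps)
      then have "(a + b) * s powr p = a * (s powr p + p * s powr (p - 1) * (\<bar>u\<bar> / a - s))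
          + b * (s powr p + p * s powr (p - 1) * (\<bar>v\<bar> / b - s))"
        by algebra
      also have "\<dots> \<le> a * (\<bar>u\<bar> / a) powr p + b * (\<bar>v\<bar> / b) powr p"
        using 1 2 ab by (intro add_mono mult_left_mono) auto
      also have "\<dots> = a powr (1 - p) * \<bar>u\<bar> powr p + b powr (1 - p) * \<bar>v\<bar> powr p"
        using ab by (simp add: powr_divide powr_diff)
      finally have 3: "(a + b) powr (p - 1) * ((a + b) * s powr p) \<le> (a + b) powr (p - 1) * (a powr (1 - p) * \<bar>u\<bar> powr p + b powr (1 - p) * \<bar>v\<bar> powr p)"
        by (intro mult_left_mono) auto
      have "\<bar>u + v\<bar> powr p \<le> (\<bar>u\<bar> + \<bar>v\<bar>) powr p"
        using p by (intro powr_mono2) auto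
      also have "\<dots> = (a + b) powr (p - 1) * ((a + b) * s powr p)"
        using ab by (simp add: s_def powr_divide powr_diff)
      finally show ?thesis using 3 by simp
    qed
  qed
  let ?I = "\<lambda>h. (\<integral>\<^sup>+x\<in>S. ennreal (\<bar>h x\<bar> powr p) \<partial>lborel)"
  have "(\<integral>\<^sup>+x\<in>S. ennreal (\<bar>f x + g x\<bar> powr p) \<partial>lborel)
    \<le> (\<integral>\<^sup>+x. ennreal ((a + b) powr (p - 1) * a powr (1 - p)) * (ennreal (\<bar>f x\<bar> powr p) * indicator S x)
        + ennreal ((a + b) powr (p - 1) * b powr (1 - p)) * (ennreal (\<bar>g x\<bar> powr p) * indicator S x) \<partial>lborel)"
  proof (intro nn_integral_mono)
    fix x
    show "ennreal (\<bar>f x + g x\<bar> powr p) * indicator S x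
      \<le> ennreal ((a + b) powr (p - 1) * a powr (1 - p)) * (ennreal (\<bar>f x\<bar> powr p) * indicator S x)
        + ennreal ((a + b) powr (p - 1) * b powr (1 - p)) * (ennreal (\<bar>g x\<bar> powr p) * indicator S x)"
      using conv[of "f x" "g x"]
      by (auto simp: distrib_left mult.assoc split: split_indicator
          simp flip: ennreal_mult ennreal_plus intro!: ennreal_leI)
  qed
  also have "\<dots> = ennreal ((a + b) powr (p - 1) * a powr (1 - p)) * ?I f
      + ennreal ((a + b) powr (p - 1) * b powr (1 - p)) * ?I g"
    by (simp add: nn_integral_add nn_integral_cmult)
  also have "\<dots> \<le> ennreal ((a + b) powr (p - 1) * a powr (1 - p)) * ennreal (a powr p)
      + ennreal ((a + b) powr (p - 1) * b powr (1 - p)) * ennreal (b powr p)"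
    using fa gb by (intro add_mono mult_left_mono) (auto simp: Lp_bounded_def)
  also have "\<dots> = ennreal ((a + b) powr (p - 1) * (a powr (1 - p) * a powr p + b powr (1 - p) * b powr p))"
    by (simp add: algebra_simps flip: ennreal_mult ennreal_plus)
  also have "(a + b) powr (p - 1) * (a powr (1 - p) * a powr p + b powr (1 - p) * b powr p) = (a + b) powr p"
    using ab by (simp add: powr_diff)
  finally show "Lp_bounded p S (\<lambda>x. f x + g x) (A + B + e)"
    using ab by (simp add: Lp_bounded_def)
qed (use A B p in auto)

section \<open>First and second antiderivatives\<close>

definition prim1 :: "(real \<Rightarrow> real) \<Rightarrow> real \<Rightarrow> real" where
  "prim1 f y = (\<integral>u. (if u \<le> y then f u else 0) \<partial>lborel)"

text \<open>Cauchy's formula for the second antiderivative of a function that vanishes on the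
  negative axis.\<close>

definition prim2 :: "(real \<Rightarrow> real) \<Rightarrow> real \<Rightarrow> real" where
  "prim2 f y = (\<integral>u. max 0 (y - u) * f u \<partial>lborel)"

lemma integrable_cut:
  fixes f :: "real \<Rightarrow> real"
  assumes f: "integrable lborel f" and [measurable]: "Measurable.pred borel P"
  shows "integrable lborel (\<lambda>u. if P u then f u else 0)"
proof (rule Bochner_Integration.integrable_bound[OF f])
  have [measurable]: "f \<in> borel_measurable borel" using f by auto
  show "(\<lambda>u. if P u then f u else 0) \<in> borel_measurable lborel" by measurable
qed auto

lemma integrable_hinge:
  fixes f :: "real \<Rightarrow> real"
  assumes f: "integrable lborel f" and supp: "\<And>u. u \<notin> {0..1} \<Longrightarrow> f u = 0"
  shows "integrable lborel (\<lambda>u. max 0 (y - u) * f u)"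
proof (rule Bochner_Integration.integrable_bound)
  have [measurable]: "f \<in> borel_measurable borel" using f by auto
  show "integrable lborel (\<lambda>u. (\<bar>y\<bar> + 1) * f u)" using f by simp
  show "(\<lambda>u. max 0 (y - u) * f u) \<in> borel_measurable lborel" by measurable
  show "AE u in lborel. norm (max 0 (y - u) * f u) \<le> norm ((\<bar>y\<bar> + 1) * f u)"
  proof (rule AE_I2)
    fix u
    show "norm (max 0 (y - u) * f u) \<le> norm ((\<bar>y\<bar> + 1) * f u)"
      using supp[of u] by (cases "u \<in> {0..1}") (auto simp: abs_mult intro!: mult_right_mono)
  qed
qed

lemma borel_measurable_prim1 [measurable]:
  assumes [measurable]: "f \<in> borel_measurable borel"
  shows "prim1 f \<in> borel_measurable borel"
  unfolding prim1_def[abs_def] by measurable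

lemma borel_measurable_prim2 [measurable]:
  assumes [measurable]: "f \<in> borel_measurable borel"
  shows "prim2 f \<in> borel_measurable borel"
  unfolding prim2_def[abs_def] by measurable

lemma abs_prim1_le:
  assumes f: "integrable lborel f"
  shows "\<bar>prim1 f y\<bar> \<le> (\<integral>u. \<bar>f u\<bar> \<partial>lborel)"
proof -
  have "\<bar>prim1 f y\<bar> \<le> (\<integral>u. \<bar>if u \<le> y then f u else 0\<bar> \<partial>lborel)"
    unfolding prim1_def by (rule integral_abs_bound)
  also have "\<dots> \<le> (\<integral>u. \<bar>f u\<bar> \<partial>lborel)"
    using f integrable_cut[OF f, of "\<lambda>u. u \<le> y"] by (intro integral_mono) auto
  finally show ?thesis .
qed

lemma set_integrable_prim1_affine:
  assumes f: "integrable lborel f"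
  shows "set_integrable lborel {0..d} (\<lambda>t. prim1 f (c + s * t))"
  unfolding set_integrable_def
proof (rule Bochner_Integration.integrable_bound)
  have [measurable]: "f \<in> borel_measurable borel" using f by auto
  show "integrable lborel (\<lambda>t. indicator {0..d} t * (\<integral>u. \<bar>f u\<bar> \<partial>lborel))"
    by (intro integrable_mult_left integrable_real_indicator) (auto simp: emeasure_lborel_Icc_eq)
  show "(\<lambda>x. indicat_real {0..d} x *\<^sub>R prim1 f (c + s * x)) \<in> borel_measurable lborel" by measurable
  show "AE t in lborel. norm (indicat_real {0..d} t *\<^sub>R prim1 f (c + s * t))
     \<le> norm (indicator {0..d} t * (\<integral>u. \<bar>f u\<bar> \<partial>lborel))"
    using abs_prim1_le[OF f] by (auto split: split_indicator intro: order_trans)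
qed

lemma prim1_diff:
  assumes f: "integrable lborel f" and s: "0 < s" and d: "0 \<le> d"
  shows "s * (LINT t:{0..d}|lborel. f (c + s * t)) = prim1 f (c + s * d) - prim1 f c"
proof -
  have "prim1 f (c + s * d) - prim1 f c
      = (\<integral>u. (if u \<le> c + s * d then f u else 0) - (if u \<le> c then f u else 0) \<partial>lborel)"
    unfolding prim1_def
    by (rule Bochner_Integration.integral_diff[symmetric]) (intro integrable_cut f; measurable)+
  also have "\<dots> = s * (\<integral>t. (if c + s * t \<le> c + s * d then f (c + s * t) else 0)
      - (if c + s * t \<le> c then f (c + s * t) else 0) \<partial>lborel)"
    using s by (subst lborel_integral_real_affine[where c=s and t=c]) auto
  also have "(\<integral>t. (if c + s * t \<le> c + s * d then f (c + s * t) else 0)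
      - (if c + s * t \<le> c then f (c + s * t) else 0) \<partial>lborel) = (LINT t:{0..d}|lborel. f (c + s * t))"
    unfolding set_lebesgue_integral_def
  proof (rule integral_cong_AE)
    have [measurable]: "f \<in> borel_measurable borel" using f by auto
    \<comment> \<open>the two sides differ only at the end point \<open>t = 0\<close>\<close>
    show "AE t in lborel. (if c + s * t \<le> c + s * d then f (c + s * t) else 0)
      - (if c + s * t \<le> c then f (c + s * t) else 0) = indicat_real {0..d} t *\<^sub>R f (c + s * t)"
      using AE_lborel_singleton[of 0]
      by eventually_elim (use s d in \<open>auto split: split_indicator simp: mult_le_0_iff\<close>)
  qed (use f in measurable)
  finally show ?thesis by simp
qed

lemma integral_hinge_diff:
  fixes s :: real
  assumes s: "0 < s" and d: "0 \<le> d"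
  shows "s * (LINT t:{0..d}|lborel. (if u \<le> c + s * t then 1 else 0)) = max 0 (c + s * d - u) - max 0 (c - u)"
proof -
  \<comment> \<open>the point from which on the step function is \<open>1\<close>\<close>
  define e where "e = max 0 ((u - c) / s)"
  have e: "0 \<le> e" by (simp add: e_def)
  have "(LINT t:{0..d}|lborel. (if u \<le> c + s * t then 1 else 0 :: real)) = (\<integral>t. indicator {e..d} t \<partial>lborel)"
    unfolding set_lebesgue_integral_def
    using s by (intro Bochner_Integration.integral_cong) (auto simp: e_def field_simps split: split_indicator)
  also have "\<dots> = max 0 (d - e)"
    by (auto simp: measure_lborel_Icc max_def)
  also have "s * \<dots> = max 0 (c + s * d - u) - max 0 (c - u)"
  proof (cases "u \<le> c")
    case True
    then have "e = 0" using s by (auto simp: e_def max_def field_simps)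
    moreover have "0 \<le> s * d" using s d by simp
    ultimately show ?thesis using True d by (auto simp: max_def)
  next
    case False
    then have "s * e = u - c" using s by (auto simp: e_def max_def field_simps)
    then have "s * max 0 (d - e) = max 0 (s * d - (u - c))"
      using s by (simp add: max_mult_distrib_left right_diff_distrib)
    then show ?thesis using False by (simp add: algebra_simps)
  qed
  finally show ?thesis .
qed

text \<open>The second antiderivative has the first one as its derivative, in the integrated form that
  is needed along affine substitutions: by Fubini, a hinge is the integral of a step.\<close>

lemma prim2_diff:
  assumes f: "integrable lborel f" and supp: "\<And>u. u \<notin> {0..1} \<Longrightarrow> f u = 0"
    and s: "0 < s" and d: "0 \<le> d"
  shows "s * (LINT t:{0..d}|lborel. prim1 f (c + s * t)) = prim2 f (c + s * d) - prim2 f c"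
proof -
  have [measurable]: "f \<in> borel_measurable borel" using f by auto
  let ?g = "\<lambda>t u. indicator {0..d} t * (if u \<le> c + s * t then f u else 0) :: real"
  have int: "integrable (lborel \<Otimes>\<^sub>M lborel) (\<lambda>(t, u). ?g t u)"
  proof (rule Bochner_Integration.integrable_bound)
    show "integrable (lborel \<Otimes>\<^sub>M lborel) (\<lambda>(t, u). indicat_real {0..d} t * f u)"
    proof (rule lborel_pair.Fubini_integrable)
      show "integrable lborel (\<lambda>t. \<integral>u. norm (case (t, u) of (t, u) \<Rightarrow> indicat_real {0..d} t * f u) \<partial>lborel)"
        by (simp add: abs_mult emeasure_lborel_Icc_eq)
    qed (use f in auto)
    show "(\<lambda>(t, u). ?g t u) \<in> borel_measurable (lborel \<Otimes>\<^sub>M lborel)"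
      by measurable
  qed (auto split: split_indicator)
  have "(LINT t:{0..d}|lborel. prim1 f (c + s * t)) = (\<integral>t. \<integral>u. ?g t u \<partial>lborel \<partial>lborel)"
    unfolding set_lebesgue_integral_def prim1_def by simp
  also have "\<dots> = (\<integral>u. \<integral>t. ?g t u \<partial>lborel \<partial>lborel)"
    by (rule lborel_pair.Fubini_integral[OF int, symmetric])
  also have "(\<lambda>u. \<integral>t. ?g t u \<partial>lborel) = (\<lambda>u. (LINT t:{0..d}|lborel. (if u \<le> c + s * t then 1 else 0)) * f u)"
  proof
    fix u
    have "(\<integral>t. ?g t u \<partial>lborel) = (\<integral>t. (indicator {0..d} t * (if u \<le> c + s * t then 1 else 0)) * f u \<partial>lborel)"
      by (intro Bochner_Integration.integral_cong) auto
    also have "\<dots> = (LINT t:{0..d}|lborel. (if u \<le> c + s * t then 1 else 0)) * f u"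
      unfolding set_lebesgue_integral_def by (simp only: integral_mult_left_zero real_scaleR_def)
    finally show "(\<integral>t. ?g t u \<partial>lborel) = (LINT t:{0..d}|lborel. (if u \<le> c + s * t then 1 else 0)) * f u" .
  qed
  finally have "s * (LINT t:{0..d}|lborel. prim1 f (c + s * t))
      = (\<integral>u. s * (LINT t:{0..d}|lborel. (if u \<le> c + s * t then 1 else 0)) * f u \<partial>lborel)"
    by (simp add: mult.assoc)
  also have "\<dots> = (\<integral>u. max 0 (c + s * d - u) * f u - max 0 (c - u) * f u \<partial>lborel)"
    unfolding integral_hinge_diff[OF s d] by (simp add: left_diff_distrib)
  also have "\<dots> = prim2 f (c + s * d) - prim2 f c"
    unfolding prim2_def by (intro Bochner_Integration.integral_diff integrable_hinge f supp)
  finally show ?thesis .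
qed

section \<open>The fundamental theorem of calculus for absolutely continuous functions\<close>

text \<open>A Henstock gauge proof. At points of differentiability the gauge makes the difference
  quotient accurate. A point of the null set \<open>N\<close> gets a neighbourhood inside an open set \<open>U\<close> of
  measure less than \<open>\<delta>\<close>; the intervals tagged in \<open>N\<close> then have total length less than \<open>\<delta>\<close>, and absolute
  continuity makes the increments of \<open>F\<close> over them negligible.\<close>

lemma abs_continuous_FTC:
  fixes F f :: "real \<Rightarrow> real"
  assumes ac: "abs_continuous_on {a..b} F" and ab: "a \<le> b" and N: "negligible N"
    and der: "\<And>x. x \<in> {a..b} - N \<Longrightarrow> (F has_vector_derivative f x) (at x within {a..b})"
  shows "(f has_integral (F b - F a)) {a..b}"
proof -
  define f' where "f' = (\<lambda>x. if x \<in> N then 0 else f x)"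
  have "(f' has_integral (F b - F a)) {a..b}"
    unfolding has_integral_real
  proof (intro allI impI)
    fix e :: real assume e: "0 < e"
    define r where "r = e / (2 * (b - a + 1))"
    have r: "0 < r" "r * (b - a) < e / 2"
      using e ab by (auto simp: r_def field_simps)
    obtain \<delta> where \<delta>: "0 < \<delta>" and
      small: "\<And>\<D>. \<D> division_of \<Union>\<D> \<Longrightarrow> \<Union>\<D> \<subseteq> {a..b} \<Longrightarrow> (\<Sum>I\<in>\<D>. (Sup I - Inf I)) < \<delta>
         \<Longrightarrow> (\<Sum>I\<in>\<D>. \<bar>F (Sup I) - F (Inf I)\<bar>) < e / 2"
      using ac e unfolding abs_continuous_on_def by (meson half_gt_zero)
    have Nl: "N \<in> sets lebesgue" "emeasure lebesgue N = 0"
      using N by (auto simp: negligible_iff_null_sets null_sets_def)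
    obtain U where U: "open U" "N \<subseteq> U" "U - N \<in> lmeasurable" "emeasure lebesgue (U - N) < ennreal \<delta>"
      using sets_lebesgue_outer_open[OF Nl(1) \<delta>] by blast
    have Ul: "U \<in> sets lebesgue" using U(1) by auto
    have "emeasure lebesgue U \<le> emeasure lebesgue (U - N) + emeasure lebesgue N"
      using emeasure_subadditive[of "U - N" lebesgue N] U Nl Ul by (simp add: Un_absorb2)
    then have Um: "emeasure lebesgue U < ennreal \<delta>"
      using U(4) Nl by simp
    have "\<forall>x. \<exists>d>0. x \<in> {a..b} - N \<longrightarrow>
         (\<forall>y\<in>{a..b}. norm (y-x) < d \<longrightarrow> norm (F y - F x - (y-x) *\<^sub>R f x) \<le> r * norm (y-x))"
      using der r(1) unfolding has_vector_derivative_def has_derivative_within_alt by blast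
    then obtain d where d0: "\<And>x. 0 < d x" and
       d: "\<And>x y. \<lbrakk>x \<in> {a..b} - N; y \<in> {a..b}; \<bar>y-x\<bar> < d x\<rbrakk>
                        \<Longrightarrow> \<bar>F y - F x - (y-x) * f x\<bar> \<le> r * \<bar>y-x\<bar>"
      by (simp only: real_norm_def real_scaleR_def) metis
    define \<gamma> where "\<gamma> = (\<lambda>x. if x \<in> N then U else ball x (d x))"
    have gau: "gauge \<gamma>"
      using U d0 by (auto simp: gauge_def \<gamma>_def)
    have est: "norm ((\<Sum>(x, K)\<in>p. measure lborel K *\<^sub>R f' x) - (F b - F a)) < e"
      if p: "p tagged_division_of {a..b}" and fine: "\<gamma> fine p" for p
    proof -
      define D where "D = (\<lambda>K. F (Sup K) - F (Inf K))"
      have fin: "finite p" using p by blast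
      have K: "\<exists>u v. K = {u..v} \<and> u \<le> x \<and> x \<le> v \<and> a \<le> u \<and> v \<le> b \<and> K \<subseteq> \<gamma> x" if "(x, K) \<in> p" for x K
      proof -
        obtain u v where uv: "K = cbox u v" using p \<open>(x, K) \<in> p\<close> by blast
        have "x \<in> K" "K \<subseteq> {a..b}" using p \<open>(x, K) \<in> p\<close> by blast+
        moreover have "K \<subseteq> \<gamma> x" using fine \<open>(x, K) \<in> p\<close> by (auto simp: fine_def)
        ultimately show ?thesis using uv by auto
      qed
      define q where "q = {xK \<in> p. fst xK \<in> N}"
      have qp: "q \<subseteq> p" by (auto simp: q_def)
      have FF: "F b - F a = (\<Sum>xK\<in>p. D (snd xK))"
        using additive_tagged_division_1[OF ab p, of F] by (simp add: D_def case_prod_beta)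
      have bma: "b - a = (\<Sum>xK\<in>p. measure lborel (snd xK))"
        using additive_content_tagged_division[of p a b] p ab by (simp add: case_prod_beta)
      have "(\<Sum>(x, K)\<in>p. measure lborel K *\<^sub>R f' x) - (F b - F a)
          = (\<Sum>xK\<in>p. measure lborel (snd xK) * f' (fst xK) - D (snd xK))"
        by (simp add: FF sum_subtractf case_prod_beta)
      also have "\<dots> = (\<Sum>xK\<in>q. measure lborel (snd xK) * f' (fst xK) - D (snd xK))
          + (\<Sum>xK\<in>p - q. measure lborel (snd xK) * f' (fst xK) - D (snd xK))"
        using sum.subset_diff[OF qp fin] by (simp add: add.commute)
      also have "\<bar>\<dots>\<bar> < e"
      proof -
        have "\<bar>\<Sum>xK\<in>q. measure lborel (snd xK) * f' (fst xK) - D (snd xK)\<bar> = \<bar>\<Sum>xK\<in>q. - D (snd xK)\<bar>"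
          by (rule arg_cong[where f=abs], rule sum.cong) (auto simp: q_def f'_def)
        also have "\<dots> \<le> (\<Sum>xK\<in>q. \<bar>D (snd xK)\<bar>)"
          by (rule order_trans[OF sum_abs]) simp
        also have "\<dots> < e / 2"
        proof -
          have qt: "q tagged_partial_division_of {a..b}"
            using p qp tagged_partial_division_subset by (metis tagged_division_of_def)
          have qd: "q tagged_division_of \<Union>(snd ` q)"
            by (rule tagged_partial_division_of_Union_self[OF qt])
          have dv: "snd ` q division_of \<Union>(snd ` q)"
            by (rule partial_division_of_tagged_division[OF qt])
          have eq: "(\<Sum>xK\<in>q. \<bar>D (snd xK)\<bar>) = (\<Sum>I\<in>snd ` q. \<bar>D I\<bar>)"
          proof -
            \<comment> \<open>degenerate intervals may occur under several tags, but contribute \<open>0\<close>; \<open>D\<close> is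
              unspecified on the empty set, which is not a member of the division\<close>
            define D' where "D' = (\<lambda>K. if K = {} then 0 else \<bar>D K\<bar>)"
            have ne: "K \<noteq> {}" if "(x, K) \<in> q" for x K
              using K[of x K] that qp by (metis subsetD atLeastatMost_empty_iff order_trans)
            have "(\<Sum>xK\<in>q. \<bar>D (snd xK)\<bar>) = (\<Sum>(x, K)\<in>q. D' K)"
              using ne by (intro sum.cong) (auto simp: D'_def)
            also have "\<dots> = (\<Sum>I\<in>snd ` q. D' I)"
              by (rule sum.over_tagged_division_lemma[OF qd]) (auto simp: D'_def D_def)
            also have "\<dots> = (\<Sum>I\<in>snd ` q. \<bar>D I\<bar>)"
              using ne by (intro sum.cong) (auto simp: D'_def)
            finally show ?thesis .
          qed
          have subU: "\<Union>(snd ` q) \<subseteq> U"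
            using K by (fastforce simp: q_def \<gamma>_def split: if_splits)
          have "(\<Sum>I\<in>snd ` q. (Sup I - Inf I)) = (\<Sum>I\<in>snd ` q. measure lebesgue I)"
            using K qp by (intro sum.cong) fastforce+
          also have "\<dots> = measure lebesgue (\<Union>(snd ` q))"
            using content_division[OF dv] by simp
          also have "ennreal \<dots> \<le> emeasure lebesgue U"
          proof -
            have "\<Union>(snd ` q) \<in> lmeasurable"
              using dv by (metis lmeasurable_division)
            then have "ennreal (measure lebesgue (\<Union>(snd ` q))) = emeasure lebesgue (\<Union>(snd ` q))"
              by (simp add: emeasure_eq_measure2 fmeasurableD2)
            also have "\<dots> \<le> emeasure lebesgue U"
              by (intro emeasure_mono subU Ul)
            finally show ?thesis .
          qed
          finally have "ennreal (\<Sum>I\<in>snd ` q. (Sup I - Inf I)) < ennreal \<delta>"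
            using Um by (rule le_less_trans)
          then have "(\<Sum>I\<in>snd ` q. (Sup I - Inf I)) < \<delta>"
            using ennreal_lessI[OF \<delta>] by (meson ennreal_leI linorder_not_le)
          moreover have "\<Union>(snd ` q) \<subseteq> {a..b}"
            using K qp by fastforce
          ultimately show ?thesis
            using small[OF dv] eq by (simp add: D_def)
        qed
        finally have 1: "\<bar>\<Sum>xK\<in>q. measure lborel (snd xK) * f' (fst xK) - D (snd xK)\<bar> < e / 2" .
        have "\<bar>\<Sum>xK\<in>p - q. measure lborel (snd xK) * f' (fst xK) - D (snd xK)\<bar>
           \<le> (\<Sum>xK\<in>p - q. r * measure lborel (snd xK))"
        proof (rule order_trans[OF sum_abs], rule sum_mono)
          fix xK assume xK: "xK \<in> p - q"
          obtain x K' where xKe: "xK = (x, K')" by (cases xK)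
          obtain u v where uv: "K' = {u..v}" "u \<le> x" "x \<le> v" "a \<le> u" "v \<le> b" "K' \<subseteq> \<gamma> x"
            using K[of x K'] xK xKe by auto
          have xN: "x \<notin> N" using xK xKe by (auto simp: q_def)
          then have "K' \<subseteq> ball x (d x)" using uv by (simp add: \<gamma>_def)
          moreover have "u \<in> K'" "v \<in> K'" using uv by auto
          ultimately have "u \<in> ball x (d x)" "v \<in> ball x (d x)" by blast+
          then have "\<bar>u - x\<bar> < d x" "\<bar>v - x\<bar> < d x"
            by (simp_all add: dist_real_def abs_minus_commute)
          moreover have "x \<in> {a..b} - N" "u \<in> {a..b}" "v \<in> {a..b}"
            using xN uv by simp_all
          ultimately have "\<bar>F u - F x - (u-x) * f x\<bar> \<le> r * \<bar>u-x\<bar>" "\<bar>F v - F x - (v-x) * f x\<bar> \<le> r * \<bar>v-x\<bar>"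
            using d by blast+
          then have "\<bar>F u - F x - (u-x) * f x\<bar> \<le> r * (x - u)" "\<bar>F v - F x - (v-x) * f x\<bar> \<le> r * (v - x)"
            using uv by simp_all
          moreover have "(v - u) * f x - (F v - F u) = (F u - F x - (u-x) * f x) - (F v - F x - (v-x) * f x)"
            by (simp add: algebra_simps)
          ultimately have "\<bar>(v - u) * f x - (F v - F u)\<bar> \<le> r * (x - u) + r * (v - x)"
            by linarith
          then show "\<bar>measure lborel (snd xK) * f' (fst xK) - D (snd xK)\<bar> \<le> r * measure lborel (snd xK)"
            using uv xN xKe by (simp add: D_def f'_def algebra_simps)
        qed
        also have "\<dots> \<le> (\<Sum>xK\<in>p. r * measure lborel (snd xK))"
          using fin r by (intro sum_mono2) auto
        also have "\<dots> = r * (b - a)"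
          by (simp add: bma sum_distrib_left)
        finally show ?thesis using 1 r by linarith
      qed
      finally show ?thesis by simp
    qed
    show "\<exists>\<gamma>. gauge \<gamma> \<and> (\<forall>p. p tagged_division_of {a..b} \<and> \<gamma> fine p \<longrightarrow>
        norm ((\<Sum>(x, K)\<in>p. measure lborel K *\<^sub>R f' x) - (F b - F a)) < e)"
      by (intro exI[of _ \<gamma>] conjI allI impI gau est) simp_all
  qed
  then show ?thesis
    by (rule has_integral_spike[OF N, rotated]) (auto simp: f'_def)
qed

section \<open>Approximation by Bernstein polynomials\<close>

text \<open>The Peano kernel of the Bernstein operator: its error on the hinge with corner \<open>u\<close>.\<close>

definition bernstein_kernel :: "nat \<Rightarrow> real \<Rightarrow> real \<Rightarrow> real" where
  "bernstein_kernel n x u = bernstein_op n (\<lambda>t. max 0 (t - u)) x - max 0 (x - u)"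

lemma bernstein_op_linear:
  assumes "0 < n"
  shows "bernstein_op n (\<lambda>t. a + b * t) x = a + b * x"
proof -
  have "bernstein_op n (\<lambda>t. a + b * t) x
      = a * (\<Sum>k\<le>n. Bernstein n k x) + b / real n * (\<Sum>k\<le>n. real k * Bernstein n k x)"
    by (simp add: bernstein_op_def distrib_right sum.distrib sum_distrib_left mult.assoc del: sum_Bernstein sum_k_Bernstein)
  then show ?thesis using assms by simp
qed

lemma bernstein_op_square:
  assumes "0 < n"
  shows "bernstein_op n (\<lambda>t. t\<^sup>2) x = x\<^sup>2 + x * (1 - x) / real n"
proof -
  have "bernstein_op n (\<lambda>t. t\<^sup>2) x
      = (1 / (real n)\<^sup>2) * ((\<Sum>k\<le>n. real k * (real k - 1) * Bernstein n k x) + (\<Sum>k\<le>n. real k * Bernstein n k x))"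
    by (simp add: bernstein_op_def sum_distrib_left power_divide power2_eq_square algebra_simps
        flip: sum.distrib del: sum_kk_Bernstein sum_k_Bernstein)
  also have "\<dots> = (1 / (real n)\<^sup>2) * (real n * (real n - 1) * x\<^sup>2 + real n * x)"
    by (simp only: sum_kk_Bernstein sum_k_Bernstein)
  also have "\<dots> = x\<^sup>2 + x * (1 - x) / real n"
    using assms by (simp add: field_simps power2_eq_square)
  finally show ?thesis .
qed

text \<open>The operator is positive and reproduces \<open>t - u\<close>, and the hinge dominates both \<open>t - u\<close> and
  \<open>0\<close>.\<close>

lemma bernstein_kernel_nonneg:
  assumes x: "x \<in> {0..1}" and n: "0 < n"
  shows "0 \<le> bernstein_kernel n x u"
proof -
  have B: "0 \<le> Bernstein n k x" for k using x by (simp add: Bernstein_nonneg)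
  have "x - u = bernstein_op n (\<lambda>t. - u + 1 * t) x"
    using bernstein_op_linear[OF n, of "-u" 1 x] by simp
  also have "\<dots> \<le> bernstein_op n (\<lambda>t. max 0 (t - u)) x"
    unfolding bernstein_op_def by (intro sum_mono mult_right_mono B) auto
  finally have "x - u \<le> bernstein_op n (\<lambda>t. max 0 (t - u)) x" .
  moreover have "0 \<le> bernstein_op n (\<lambda>t. max 0 (t - u)) x"
    unfolding bernstein_op_def by (intro sum_nonneg mult_nonneg_nonneg B) auto
  ultimately show ?thesis by (simp add: bernstein_kernel_def)
qed

lemma has_integral_hinge_left:
  fixes a b c :: real
  assumes "a \<le> c" "c \<le> b"
  shows "((\<lambda>u. max 0 (c - u)) has_integral (c - a)\<^sup>2 / 2) {a..b}"
proof -
  have "((\<lambda>u. c - u) has_integral (- (c - c)\<^sup>2 / 2 - (- (c - a)\<^sup>2 / 2))) {a..c}"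
    using assms
    by (intro fundamental_theorem_of_calculus)
       (auto intro!: derivative_eq_intros simp: field_simps simp flip: has_real_derivative_iff_has_vector_derivative)
  then have "((\<lambda>u. max 0 (c - u)) has_integral (c - a)\<^sup>2 / 2) {a..c}"
    by (rule has_integral_eq[rotated, THEN has_integral_eq_rhs]) auto
  moreover have "((\<lambda>u. max 0 (c - u)) has_integral 0) {c..b}"
    by (rule has_integral_is_0) auto
  ultimately have "((\<lambda>u. max 0 (c - u)) has_integral ((c - a)\<^sup>2 / 2 + 0)) {a..b}"
    using assms by (intro has_integral_combine[where c = c])
  then show ?thesis by simp
qed

lemma has_integral_hinge_right:
  fixes a b c :: real
  assumes "a \<le> c" "c \<le> b"
  shows "((\<lambda>x. max 0 (x - c)) has_integral (b - c)\<^sup>2 / 2) {a..b}"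
proof -
  have "((\<lambda>x. x - c) has_integral ((b - c)\<^sup>2 / 2 - (c - c)\<^sup>2 / 2)) {c..b}"
    using assms
    by (intro fundamental_theorem_of_calculus)
       (auto intro!: derivative_eq_intros simp: field_simps simp flip: has_real_derivative_iff_has_vector_derivative)
  then have "((\<lambda>x. max 0 (x - c)) has_integral (b - c)\<^sup>2 / 2) {c..b}"
    by (rule has_integral_eq[rotated, THEN has_integral_eq_rhs]) auto
  moreover have "((\<lambda>x. max 0 (x - c)) has_integral 0) {a..c}"
    by (rule has_integral_is_0) auto
  ultimately have "((\<lambda>x. max 0 (x - c)) has_integral (0 + (b - c)\<^sup>2 / 2)) {a..b}"
    using assms by (intro has_integral_combine[where c = c])
  then show ?thesis by simp
qed

lemma has_integral_Bernstein:
  assumes "k \<le> n"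
  shows "(Bernstein n k has_integral 1 / (real n + 1)) {0..1}"
proof -
  have v0: "Beta (real k + 1) (real (n - k) + 1) = fact k * fact (n - k) / fact (n + 1)"
  proof -
    have "Gamma (real k + 1) = fact k" "Gamma (real (n - k) + 1) = fact (n - k)"
      using Gamma_fact[of k, where 'a=real] Gamma_fact[of "n - k", where 'a=real] by (simp_all add: add.commute)
    moreover have "Gamma (real k + 1 + (real (n - k) + 1)) = fact (n + 1)"
      using Gamma_fact[of "n + 1", where 'a=real] assms by (simp add: of_nat_diff algebra_simps)
    ultimately show ?thesis by (simp add: Beta_def)
  qed
  have v: "real (n choose k) * Beta (real k + 1) (real (n - k) + 1) = 1 / (real n + 1)"
  proof -
    have "fact (n + 1) = (real n + 1) * fact n"
      by (simp add: algebra_simps)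
    moreover have "real (n choose k) = fact n / (fact k * fact (n - k))"
      using assms by (rule binomial_fact)
    moreover have "(f / (g * h)) * (g * h / (m * f)) = 1 / m" if "f \<noteq> 0" "g \<noteq> 0" "h \<noteq> 0" for f g h m :: real
      using that by simp
    ultimately show ?thesis using v0 by simp
  qed
  have "((\<lambda>t. t powr (real k + 1 - 1) * (1 - t) powr (real (n - k) + 1 - 1)) has_integral
      Beta (real k + 1) (real (n - k) + 1)) {0..1}"
    by (rule has_integral_Beta_real) auto
  then have "((\<lambda>t. real (n choose k) * (t powr (real k + 1 - 1) * (1 - t) powr (real (n - k) + 1 - 1))) has_integral
      1 / (real n + 1)) {0..1}"
    unfolding v[symmetric] by (rule has_integral_mult_right)
  then show ?thesis
    by (rule has_integral_spike_finite[of "{0, 1}", rotated 2])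
       (auto simp: Bernstein_def powr_realpow)
qed

text \<open>Integrating the hinges over \<open>u\<close> gives \<open>t\<^sup>2 / 2\<close>, so the row mass is half the second
  moment \<open>x (1 - x) / n\<close> of the Bernstein weights.\<close>

lemma bernstein_kernel_row:
  assumes x: "x \<in> {0..1}" and n: "0 < n"
  shows "(\<integral>\<^sup>+u\<in>{0..1}. ennreal (bernstein_kernel n x u) \<partial>lborel) \<le> ennreal (1 / real n)"
proof -
  have "((\<lambda>u. (\<Sum>k\<le>n. max 0 (real k / real n - u) * Bernstein n k x) - max 0 (x - u)) has_integral
      (\<Sum>k\<le>n. (real k / real n - 0)\<^sup>2 / 2 * Bernstein n k x) - (x - 0)\<^sup>2 / 2) {0..1}"
    using x n
    by (intro has_integral_diff has_integral_sum has_integral_mult_left has_integral_hinge_left) auto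
  moreover have "(\<Sum>k\<le>n. (real k / real n - 0)\<^sup>2 / 2 * Bernstein n k x) = bernstein_op n (\<lambda>t. t\<^sup>2) x / 2"
    by (simp add: bernstein_op_def sum_divide_distrib)
  ultimately have "(bernstein_kernel n x has_integral (x * (1 - x) / real n) / 2) {0..1}"
    by (simp add: bernstein_kernel_def[abs_def] bernstein_op_def[where f="\<lambda>t. max 0 (t - _)"] bernstein_op_square[OF n] add_divide_distrib)
  then have "(\<integral>\<^sup>+u\<in>{0..1}. ennreal (bernstein_kernel n x u) \<partial>lborel) = ennreal ((x * (1 - x) / real n) / 2)"
    by (intro nn_integral_has_integral_lebesgue' bernstein_kernel_nonneg x n)
  also have "x * (1 - x) \<le> 1 * 1"
    using x by (intro mult_mono) auto
  then have "x * (1 - x) / real n / 2 \<le> 1 / real n"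
    using n by (simp add: divide_simps)
  then have "ennreal ((x * (1 - x) / real n) / 2) \<le> ennreal (1 / real n)"
    by (rule ennreal_leI)
  finally show ?thesis .
qed

text \<open>The hinge is increasing and the integral of its values over a cell \<open>[k/n, (k+1)/n]\<close> is at
  least \<open>1 / n\<close> times the value at the left end, so all nodes but the last are covered by the
  integral. The last node contributes at most \<open>1 / n\<close>.\<close>

lemma hinge_riemann_sum:
  assumes u: "u \<in> {0..1}" and n: "0 < n"
  shows "(\<Sum>k\<le>n. max 0 (real k / real n - u)) / real n \<le> (1 - u)\<^sup>2 / 2 + 1 / real n"
proof -
  have step: "max 0 (real k / real n - u) / real n
     \<le> (max 0 (real (Suc k) / real n - u))\<^sup>2 / 2 - (max 0 (real k / real n - u))\<^sup>2 / 2" for k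
  proof -
    define a h where "a = real k / real n - u" and "h = 1 / real n"
    have h: "0 < h" using n by (simp add: h_def)
    have ah: "real (Suc k) / real n - u = a + h" by (simp add: a_def h_def add_divide_distrib)
    have "2 * (max 0 a * h) + (max 0 a)\<^sup>2 \<le> (max 0 (a + h))\<^sup>2"
    proof (cases "0 \<le> a")
      case True
      then show ?thesis using h by (simp add: max_def power2_eq_square algebra_simps)
    qed (simp add: max_def)
    then show ?thesis unfolding ah by (simp add: a_def h_def)
  qed
  have "(\<Sum>k<n. max 0 (real k / real n - u) / real n)
     \<le> (\<Sum>k<n. (max 0 (real (Suc k) / real n - u))\<^sup>2 / 2 - (max 0 (real k / real n - u))\<^sup>2 / 2)"
    by (intro sum_mono step)
  also have "\<dots> = (max 0 (real n / real n - u))\<^sup>2 / 2 - (max 0 (real 0 / real n - u))\<^sup>2 / 2"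
    by (rule sum_lessThan_telescope)
  also have "\<dots> = (1 - u)\<^sup>2 / 2" using u n by (simp add: max_def)
  finally have 1: "(\<Sum>k<n. max 0 (real k / real n - u) / real n) \<le> (1 - u)\<^sup>2 / 2" .
  have "max 0 (real n / real n - u) / real n \<le> 1 / real n"
    using u n by (intro divide_right_mono) auto
  then show ?thesis using 1
    by (simp add: lessThan_Suc_atMost[symmetric] sum_divide_distrib add_divide_distrib)
qed

text \<open>Every Bernstein polynomial has integral \<open>1 / (n + 1)\<close>, so the column mass compares a Riemann
  sum of the hinge with its integral.\<close>

lemma bernstein_kernel_col:
  assumes u: "u \<in> {0..1}" and n: "0 < n"
  shows "(\<integral>\<^sup>+x\<in>{0..1}. ennreal (bernstein_kernel n x u) \<partial>lborel) \<le> ennreal (1 / real n)"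
proof -
  let ?S = "\<Sum>k\<le>n. max 0 (real k / real n - u)"
  have "((\<lambda>x. (\<Sum>k\<le>n. max 0 (real k / real n - u) * Bernstein n k x) - max 0 (x - u)) has_integral
      (\<Sum>k\<le>n. max 0 (real k / real n - u) * (1 / (real n + 1))) - (1 - u)\<^sup>2 / 2) {0..1}"
    using u
    by (intro has_integral_diff has_integral_sum has_integral_mult_right has_integral_hinge_right has_integral_Bernstein) auto
  then have "((\<lambda>x. bernstein_kernel n x u) has_integral ?S / (real n + 1) - (1 - u)\<^sup>2 / 2) {0..1}"
    by (simp add: bernstein_kernel_def bernstein_op_def sum_divide_distrib)
  then have "(\<integral>\<^sup>+x\<in>{0..1}. ennreal (bernstein_kernel n x u) \<partial>lborel) = ennreal (?S / (real n + 1) - (1 - u)\<^sup>2 / 2)"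
    by (intro nn_integral_has_integral_lebesgue' bernstein_kernel_nonneg n)
  also have "?S / (real n + 1) \<le> ?S / real n"
    using n by (intro divide_left_mono sum_nonneg) auto
  then have "?S / (real n + 1) - (1 - u)\<^sup>2 / 2 \<le> 1 / real n"
    using hinge_riemann_sum[OF u n] by linarith
  then have "ennreal (?S / (real n + 1) - (1 - u)\<^sup>2 / 2) \<le> ennreal (1 / real n)"
    by (rule ennreal_leI)
  finally show ?thesis .
qed

lemma borel_measurable_bernstein_op [measurable]: "bernstein_op n f \<in> borel_measurable borel"
  unfolding bernstein_op_def[abs_def] Bernstein_def by measurable

text \<open>The affine part is reproduced exactly, and the operator can be applied under the integral.\<close>

lemma bernstein_op_prim2:
  assumes h: "integrable lborel h" and supp: "\<And>u. u \<notin> {0..1} \<Longrightarrow> h u = 0" and n: "0 < n"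
  shows "bernstein_op n (\<lambda>t. a + b * t + prim2 h t) x - (a + b * x + prim2 h x)
    = (\<integral>u. bernstein_kernel n x u * h u \<partial>lborel)"
proof -
  have ih: "integrable lborel (\<lambda>u. max 0 (y - u) * h u)" for y
    by (intro integrable_hinge h supp)
  have "bernstein_op n (\<lambda>t. a + b * t + prim2 h t) x - (a + b * x + prim2 h x)
      = bernstein_op n (prim2 h) x - prim2 h x"
    using bernstein_op_linear[OF n, of a b x]
    by (simp add: bernstein_op_def distrib_right sum.distrib)
  also have "bernstein_op n (prim2 h) x = (\<integral>u. (\<Sum>k\<le>n. (max 0 (real k / real n - u) * h u) * Bernstein n k x) \<partial>lborel)"
    unfolding bernstein_op_def prim2_def
    by (subst Bochner_Integration.integral_sum, rule integrable_mult_left, rule ih,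
        simp only: integral_mult_left_zero)
  also have "\<dots> - prim2 h x = (\<integral>u. (\<Sum>k\<le>n. (max 0 (real k / real n - u) * h u) * Bernstein n k x) - max 0 (x - u) * h u \<partial>lborel)"
    unfolding prim2_def by (intro Bochner_Integration.integral_diff[symmetric] Bochner_Integration.integrable_sum integrable_mult_left ih)
  also have "\<dots> = (\<integral>u. bernstein_kernel n x u * h u \<partial>lborel)"
    by (intro Bochner_Integration.integral_cong)
       (simp_all add: bernstein_kernel_def bernstein_op_def left_diff_distrib right_diff_distrib
         sum_distrib_left sum_distrib_right mult_ac)
  finally show ?thesis .
qed

lemma bernstein_approx_prim2:
  assumes p: "1 \<le> p" and n: "0 < n"
    and h: "integrable lborel h" and supp: "\<And>u. u \<notin> {0..1} \<Longrightarrow> h u = 0"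
    and A: "Lp_bounded p {0..1} h A" "0 \<le> A"
  shows "Lp_bounded p {0..1} (\<lambda>x. (a + b * x + prim2 h x) - bernstein_op n (\<lambda>t. a + b * t + prim2 h t) x) (A / real n)"
proof -
  have [measurable]: "h \<in> borel_measurable borel" using h by auto
  let ?k = "\<lambda>x u. indicator {0..1} x * indicator {0..1} u * bernstein_kernel n x u :: real"
  have "(\<integral>\<^sup>+x. ennreal (\<bar>\<integral>u. ?k x u * h u \<partial>lborel\<bar> powr p) \<partial>lborel)
     \<le> ennreal ((1 / real n) powr p) * (\<integral>\<^sup>+u. ennreal (\<bar>h u\<bar> powr p) \<partial>lborel)"
  proof (rule schur_test[OF lborel.sigma_finite_measure_axioms lborel.sigma_finite_measure_axioms p])
    show "(\<lambda>(x, y). ?k x y) \<in> borel_measurable (lborel \<Otimes>\<^sub>M lborel)"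
      unfolding bernstein_kernel_def bernstein_op_def Bernstein_def by measurable
    show "0 \<le> ?k x y" for x y
      using bernstein_kernel_nonneg[OF _ n, of x y] by (auto split: split_indicator)
    show "(\<integral>\<^sup>+ y. ennreal (?k x y) \<partial>lborel) \<le> ennreal (1 / real n)" for x
    proof (cases "x \<in> {0..1}")
      case True
      have "(\<integral>\<^sup>+ y. ennreal (?k x y) \<partial>lborel) = (\<integral>\<^sup>+y\<in>{0..1}. ennreal (bernstein_kernel n x y) \<partial>lborel)"
        using True by (intro nn_integral_cong) (auto split: split_indicator)
      then show ?thesis using bernstein_kernel_row[OF True n] by simp
    qed simp
    show "(\<integral>\<^sup>+ x. ennreal (?k x y) \<partial>lborel) \<le> ennreal (1 / real n)" for y
    proof (cases "y \<in> {0..1}")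
      case True
      have "(\<integral>\<^sup>+ x. ennreal (?k x y) \<partial>lborel) = (\<integral>\<^sup>+x\<in>{0..1}. ennreal (bernstein_kernel n x y) \<partial>lborel)"
        using True by (intro nn_integral_cong) (auto split: split_indicator)
      then show ?thesis using bernstein_kernel_col[OF True n] by simp
    qed simp
  qed (use n in auto)
  also have "(\<integral>\<^sup>+u. ennreal (\<bar>h u\<bar> powr p) \<partial>lborel) = (\<integral>\<^sup>+u\<in>{0..1}. ennreal (\<bar>h u\<bar> powr p) \<partial>lborel)"
    using supp by (intro nn_integral_cong) (auto split: split_indicator)
  also have "ennreal ((1 / real n) powr p) * \<dots> \<le> ennreal ((1 / real n) powr p) * ennreal (A powr p)"
    using A unfolding Lp_bounded_def by (intro mult_left_mono) auto
  also have "\<dots> = ennreal ((A / real n) powr p)"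
    using A by (simp add: powr_mult powr_divide flip: ennreal_mult)
  also have "(\<integral>\<^sup>+x. ennreal (\<bar>\<integral>u. ?k x u * h u \<partial>lborel\<bar> powr p) \<partial>lborel)
    = (\<integral>\<^sup>+x\<in>{0..1}. ennreal (\<bar>(a + b * x + prim2 h x) - bernstein_op n (\<lambda>t. a + b * t + prim2 h t) x\<bar> powr p) \<partial>lborel)"
  proof (intro nn_integral_cong)
    fix x
    show "ennreal (\<bar>\<integral>u. ?k x u * h u \<partial>lborel\<bar> powr p)
      = ennreal (\<bar>(a + b * x + prim2 h x) - bernstein_op n (\<lambda>t. a + b * t + prim2 h t) x\<bar> powr p) * indicator {0..1} x"
    proof (cases "x \<in> {0..1}")
      case True
      have "(\<integral>u. ?k x u * h u \<partial>lborel) = (\<integral>u. bernstein_kernel n x u * h u \<partial>lborel)"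
        using True supp by (intro Bochner_Integration.integral_cong) (auto split: split_indicator)
      also have "\<dots> = bernstein_op n (\<lambda>t. a + b * t + prim2 h t) x - (a + b * x + prim2 h x)"
        using bernstein_op_prim2[OF h supp n] by simp
      finally show ?thesis using True by (simp add: abs_minus_commute)
    qed simp
  qed
  finally show ?thesis by (simp add: Lp_bounded_def)
qed

text \<open>Jensen with the weights \<open>Bernstein n k x\<close>, which sum to \<open>1\<close>; their integrals
  \<open>1 / (n + 1)\<close> are below the weight \<open>1 / n\<close> of the seminorm.\<close>

lemma bernstein_op_Lp_bounded:
  assumes p: "1 \<le> p" and n: "0 < n"
  shows "Lp_bounded p {0..1} (bernstein_op n f) (disc_seminorm p n f)"
proof -
  define S where "S = (\<Sum>k\<le>n. \<bar>f (real k / real n)\<bar> powr p)"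
  have S0: "0 \<le> S" by (simp add: S_def sum_nonneg)
  have pt: "\<bar>bernstein_op n f x\<bar> powr p \<le> (\<Sum>k\<le>n. \<bar>f (real k / real n)\<bar> powr p * Bernstein n k x)"
    if x: "x \<in> {0..1}" for x
  proof -
    have B: "0 \<le> Bernstein n k x" for k using x by (simp add: Bernstein_nonneg)
    have "ennreal (\<bar>\<integral>k. Bernstein n k x * f (real k / real n) \<partial>count_space {..n}\<bar> powr p)
      \<le> ennreal (1 powr (p - 1)) * (\<integral>\<^sup>+k. ennreal (Bernstein n k x * \<bar>f (real k / real n)\<bar> powr p) \<partial>count_space {..n})"
      by (rule kernel_jensen[OF p]) (auto simp: B nn_integral_count_space_finite sum_ennreal)
    then show ?thesis
      by (simp add: B nn_integral_count_space_finite sum_ennreal lebesgue_integral_count_space_finite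
          bernstein_op_def mult.commute sum_nonneg)
  qed
  have "((\<lambda>x. \<Sum>k\<le>n. \<bar>f (real k / real n)\<bar> powr p * Bernstein n k x) has_integral
      (\<Sum>k\<le>n. \<bar>f (real k / real n)\<bar> powr p * (1 / (real n + 1)))) {0..1}"
    by (intro has_integral_sum has_integral_mult_right has_integral_Bernstein) auto
  then have hi: "((\<lambda>x. \<Sum>k\<le>n. \<bar>f (real k / real n)\<bar> powr p * Bernstein n k x) has_integral S / (real n + 1)) {0..1}"
    by (simp add: S_def sum_divide_distrib)
  have "(\<integral>\<^sup>+x\<in>{0..1}. ennreal (\<bar>bernstein_op n f x\<bar> powr p) \<partial>lborel)
     \<le> (\<integral>\<^sup>+x\<in>{0..1}. ennreal (\<Sum>k\<le>n. \<bar>f (real k / real n)\<bar> powr p * Bernstein n k x) \<partial>lborel)"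
    using pt by (intro nn_integral_mono) (auto split: split_indicator intro!: ennreal_leI)
  also have "\<dots> = ennreal (S / (real n + 1))"
    by (intro nn_integral_has_integral_lebesgue' hi sum_nonneg) (auto simp: Bernstein_nonneg)
  also have "\<dots> \<le> ennreal (1 / real n * S)"
    using S0 n by (intro ennreal_leI) (auto simp: divide_simps mult_left_mono)
  also have "1 / real n * S = disc_seminorm p n f powr p"
    using p S0 n by (simp add: disc_seminorm_def powr_powr flip: S_def)
  finally show ?thesis by (simp add: Lp_bounded_def)
qed

section \<open>Steklov averages as second antiderivatives\<close>

definition second_diff :: "(real \<Rightarrow> real) \<Rightarrow> real \<Rightarrow> real \<Rightarrow> real" where
  "second_diff f h x = f x - 2 * f (x + h) + f (x + 2 * h)"

lemma borel_measurable_second_diff [measurable]: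
  assumes [measurable]: "f \<in> borel_measurable borel"
  shows "second_diff f h \<in> borel_measurable borel"
  unfolding second_diff_def[abs_def] by measurable

text \<open>The Steklov average with the sum over \<open>m\<close> written out and Lebesgue measure replaced by
  Lebesgue-Borel measure.\<close>

definition steklov_borel :: "real \<Rightarrow> (real \<Rightarrow> real) \<Rightarrow> real \<Rightarrow> real" where
  "steklov_borel \<delta> f x = 1 / \<delta>\<^sup>2 * (LINT t\<^sub>1:{0..\<delta>}|lborel. LINT t\<^sub>2:{0..\<delta>}|lborel.
     2 * f (x + ((t\<^sub>1 + t\<^sub>2) / 2 - x * \<delta>)) - f (x + 2 * ((t\<^sub>1 + t\<^sub>2) / 2 - x * \<delta>)))"

lemma set_integrable_affine:
  fixes f :: "real \<Rightarrow> real"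
  assumes "integrable lborel f" "s \<noteq> 0"
  shows "set_integrable lborel {0..d} (\<lambda>t. f (c + s * t))"
  unfolding set_integrable_def
  by (intro integrable_mult_indicator lborel_integrable_real_affine assms) auto

text \<open>As functions of \<open>t\<^sub>2\<close>, the two arguments are affine with slopes \<open>1 / 2\<close> and \<open>1\<close>, and they start
  at \<open>(1 - \<delta>) x + t\<^sub>1 / 2\<close> and \<open>(1 - 2 \<delta>) x + t\<^sub>1\<close>; so the inner integral
  is a combination of increments of \<open>prim1 f\<close>.\<close>

lemma steklov_inner:
  fixes f :: "real \<Rightarrow> real"
  assumes f: "integrable lborel f" and \<delta>: "0 < \<delta>"
  shows "(LINT t\<^sub>2:{0..\<delta>}|lborel. 2 * f (x + ((t\<^sub>1 + t\<^sub>2) / 2 - x * \<delta>)) - f (x + 2 * ((t\<^sub>1 + t\<^sub>2) / 2 - x * \<delta>)))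
    = 4 * (prim1 f ((1 - \<delta>) * x + \<delta> / 2 + 1 / 2 * t\<^sub>1) - prim1 f ((1 - \<delta>) * x + 1 / 2 * t\<^sub>1))
      - (prim1 f ((1 - 2 * \<delta>) * x + \<delta> + 1 * t\<^sub>1) - prim1 f ((1 - 2 * \<delta>) * x + 1 * t\<^sub>1))" (is ?eq)
  and "set_integrable lborel {0..\<delta>} (\<lambda>t\<^sub>2. 2 * f (x + ((t\<^sub>1 + t\<^sub>2) / 2 - x * \<delta>)) - f (x + 2 * ((t\<^sub>1 + t\<^sub>2) / 2 - x * \<delta>)))" (is ?int)
proof -
  let ?a = "(1 - \<delta>) * x + 1 / 2 * t\<^sub>1" and ?b = "(1 - 2 * \<delta>) * x + 1 * t\<^sub>1"
  have e: "(\<lambda>t\<^sub>2. 2 * f (x + ((t\<^sub>1 + t\<^sub>2) / 2 - x * \<delta>)) - f (x + 2 * ((t\<^sub>1 + t\<^sub>2) / 2 - x * \<delta>)))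
     = (\<lambda>t. 2 * f (?a + 1 / 2 * t) - f (?b + 1 * t))"
  proof
    fix t
    have "x + ((t\<^sub>1 + t) / 2 - x * \<delta>) = ?a + 1 / 2 * t" "x + 2 * ((t\<^sub>1 + t) / 2 - x * \<delta>) = ?b + 1 * t"
      by (simp_all add: field_simps)
    then show "2 * f (x + ((t\<^sub>1 + t) / 2 - x * \<delta>)) - f (x + 2 * ((t\<^sub>1 + t) / 2 - x * \<delta>))
       = 2 * f (?a + 1 / 2 * t) - f (?b + 1 * t)" by simp
  qed
  have i1: "set_integrable lborel {0..\<delta>} (\<lambda>t. 2 * f (?a + 1 / 2 * t))"
    by (intro set_integrable_mult_right set_integrable_affine f) simp
  have i2: "set_integrable lborel {0..\<delta>} (\<lambda>t. f (?b + 1 * t))"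
    by (intro set_integrable_affine f) simp
  show ?int unfolding e by (intro set_integral_diff i1 i2)
  have "(LINT t:{0..\<delta>}|lborel. 2 * f (?a + 1 / 2 * t) - f (?b + 1 * t))
     = 2 * (LINT t:{0..\<delta>}|lborel. f (?a + 1 / 2 * t)) - (LINT t:{0..\<delta>}|lborel. f (?b + 1 * t))"
    by (subst set_integral_diff[OF i1 i2]) simp
  moreover have "1 / 2 * (LINT t:{0..\<delta>}|lborel. f (?a + 1 / 2 * t)) = prim1 f (?a + 1 / 2 * \<delta>) - prim1 f ?a"
    by (rule prim1_diff[OF f]) (use \<delta> in auto)
  moreover have "1 * (LINT t:{0..\<delta>}|lborel. f (?b + 1 * t)) = prim1 f (?b + 1 * \<delta>) - prim1 f ?b"
    by (rule prim1_diff[OF f]) (use \<delta> in auto)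
  moreover have "?a + 1 / 2 * \<delta> = (1 - \<delta>) * x + \<delta> / 2 + 1 / 2 * t\<^sub>1" "?b + 1 * \<delta> = (1 - 2 * \<delta>) * x + \<delta> + 1 * t\<^sub>1"
    by simp_all
  ultimately show ?eq
    unfolding e by (simp only:) simp
qed

lemma steklov_inner_integrable:
  fixes f :: "real \<Rightarrow> real"
  assumes f: "integrable lborel f" and \<delta>: "0 < \<delta>"
  shows "set_integrable lborel {0..\<delta>} (\<lambda>t\<^sub>1. LINT t\<^sub>2:{0..\<delta>}|lborel.
     2 * f (x + ((t\<^sub>1 + t\<^sub>2) / 2 - x * \<delta>)) - f (x + 2 * ((t\<^sub>1 + t\<^sub>2) / 2 - x * \<delta>)))"
  unfolding steklov_inner(1)[OF f \<delta>]
  by (intro set_integral_diff set_integrable_mult_right set_integrable_prim1_affine f)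

text \<open>The outer integral turns increments of \<open>prim1 f\<close> into second differences of \<open>prim2 f\<close>. The
  factor \<open>8\<close> is the coefficient \<open>2\<close> of the average times \<open>2\<close> for each integration along slope \<open>1 / 2\<close>.\<close>

lemma steklov_borel_prim2:
  assumes f: "integrable lborel f" and supp: "\<And>u. u \<notin> {0..1} \<Longrightarrow> f u = 0" and \<delta>: "0 < \<delta>"
  shows "steklov_borel \<delta> f x = (8 * second_diff (prim2 f) (\<delta> / 2) ((1 - \<delta>) * x)
     - second_diff (prim2 f) \<delta> ((1 - 2 * \<delta>) * x)) / \<delta>\<^sup>2"
proof -
  note i = set_integrable_prim1_affine[OF f]
  let ?a = "(1 - \<delta>) * x" and ?b = "(1 - 2 * \<delta>) * x"
  have h: "1 / 2 * (LINT t:{0..\<delta>}|lborel. prim1 f (c + 1 / 2 * t)) = prim2 f (c + 1 / 2 * \<delta>) - prim2 f c" for c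
    by (rule prim2_diff[OF f supp]) (use \<delta> in auto)
  have o: "1 * (LINT t:{0..\<delta>}|lborel. prim1 f (c + 1 * t)) = prim2 f (c + 1 * \<delta>) - prim2 f c" for c
    by (rule prim2_diff[OF f supp]) (use \<delta> in auto)
  have "(LINT t\<^sub>1:{0..\<delta>}|lborel. 4 * (prim1 f (?a + \<delta> / 2 + 1 / 2 * t\<^sub>1) - prim1 f (?a + 1 / 2 * t\<^sub>1))
      - (prim1 f (?b + \<delta> + 1 * t\<^sub>1) - prim1 f (?b + 1 * t\<^sub>1)))
    = 4 * ((LINT t:{0..\<delta>}|lborel. prim1 f (?a + \<delta> / 2 + 1 / 2 * t)) - (LINT t:{0..\<delta>}|lborel. prim1 f (?a + 1 / 2 * t)))
      - ((LINT t:{0..\<delta>}|lborel. prim1 f (?b + \<delta> + 1 * t)) - (LINT t:{0..\<delta>}|lborel. prim1 f (?b + 1 * t)))"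
    by (subst set_integral_diff(2) | intro set_integral_diff(1) set_integrable_mult_right i | subst set_integral_mult_right | rule refl)+
  also have "\<dots> = 8 * ((prim2 f (?a + \<delta>) - prim2 f (?a + \<delta> / 2)) - (prim2 f (?a + \<delta> / 2) - prim2 f ?a))
      - ((prim2 f (?b + 2 * \<delta>) - prim2 f (?b + \<delta>)) - (prim2 f (?b + \<delta>) - prim2 f ?b))"
    using h[of "?a + \<delta> / 2"] h[of ?a] o[of "?b + \<delta>"] o[of ?b] by (simp add: add.assoc)
  finally show ?thesis
    unfolding steklov_borel_def steklov_inner(1)[OF f \<delta>] by (simp add: second_diff_def)
qed

text \<open>The second derivative of \<open>v \<mapsto> second_diff (prim2 f) k (s * v)\<close>, cut off outside
  \<open>[0,1]\<close>.\<close>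

definition restricted_second_diff :: "(real \<Rightarrow> real) \<Rightarrow> real \<Rightarrow> real \<Rightarrow> real \<Rightarrow> real" where
  "restricted_second_diff f s k v = (if v \<in> {0..1} then s\<^sup>2 * second_diff f k (s * v) else 0)"

lemma prim2_lincomb:
  assumes f: "integrable lborel f" "\<And>u. u \<notin> {0..1} \<Longrightarrow> f u = 0"
    and g: "integrable lborel g" "\<And>u. u \<notin> {0..1} \<Longrightarrow> g u = 0"
  shows "prim2 (\<lambda>u. \<alpha> * f u + \<beta> * g u) y = \<alpha> * prim2 f y + \<beta> * prim2 g y"
proof -
  have "integrable lborel (\<lambda>u. max 0 (y - u) * f u)"
    by (intro integrable_hinge f)
  moreover have "integrable lborel (\<lambda>u. max 0 (y - u) * g u)"
    by (intro integrable_hinge g)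
  ultimately have "\<alpha> * prim2 f y + \<beta> * prim2 g y
      = (\<integral>u. \<alpha> * (max 0 (y - u) * f u) + \<beta> * (max 0 (y - u) * g u) \<partial>lborel)"
    by (simp add: prim2_def)
  also have "\<dots> = prim2 (\<lambda>u. \<alpha> * f u + \<beta> * g u) y"
    unfolding prim2_def by (intro Bochner_Integration.integral_cong) (auto simp: algebra_simps)
  finally show ?thesis by simp
qed

lemma integrable_restricted_affine:
  assumes f: "integrable lborel f"
  shows "integrable lborel (\<lambda>v. if v \<in> {0..1} then s\<^sup>2 * f (y + s * v) else (0::real))"
proof (cases "s = 0")
  case False
  then show ?thesis
    by (intro integrable_cut integrable_mult_right lborel_integrable_real_affine f) auto
qed (simp cong: if_cong)

text \<open>Taylor's formula with integral remainder for \<open>prim2 f\<close> along the segment from \<open>y\<close> to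
  \<open>y + s\<close>.\<close>

lemma prim2_affine:
  assumes f: "integrable lborel f" and supp: "\<And>u. u \<notin> {0..1} \<Longrightarrow> f u = 0"
    and s: "0 \<le> s" and x: "x \<in> {0..1}"
  shows "prim2 f (y + s * x) = prim2 f y + s * prim1 f y * x
    + prim2 (\<lambda>v. if v \<in> {0..1} then s\<^sup>2 * f (y + s * v) else 0) x"
proof (cases "s = 0")
  case True
  then show ?thesis by (simp add: prim2_def cong: if_cong)
next
  case False
  then have s: "0 < s" using s by simp
  have [measurable]: "f \<in> borel_measurable borel" using f by auto
  let ?h = "\<lambda>u. if y < u then max 0 (y + s * x - u) * f u else 0"
  \<comment> \<open>The hinge at \<open>y + s * x\<close> is affine on \<open>u \<le> y\<close>: that part gives the value and the slope at
    \<open>y\<close>, and the part \<open>y < u\<close> becomes the remainder after \<open>u = y + s * v\<close>.\<close>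
  have i1: "integrable lborel (\<lambda>u. max 0 (y - u) * f u)"
    by (intro integrable_hinge f supp)
  have i2: "integrable lborel (\<lambda>u. s * x * (if u \<le> y then f u else 0))"
    by (intro integrable_mult_right integrable_cut f) measurable
  have i3: "integrable lborel ?h"
    by (intro integrable_cut integrable_hinge f supp) measurable
  have "0 \<le> s * x" using s x by simp
  then have "max 0 (y + s * x - u) * f u
      = max 0 (y - u) * f u + s * x * (if u \<le> y then f u else 0) + ?h u" for u
    by (auto simp: max_def algebra_simps)
  then have "prim2 f (y + s * x) = (\<integral>u. max 0 (y - u) * f u + s * x * (if u \<le> y then f u else 0) + ?h u \<partial>lborel)"
    unfolding prim2_def by presburger
  also have "\<dots> = prim2 f y + s * x * prim1 f y + (\<integral>u. ?h u \<partial>lborel)"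
    unfolding prim2_def prim1_def using i1 i2 i3
    by (simp add: Bochner_Integration.integral_add del: integrable_mult_right_iff)
  also have "(\<integral>u. ?h u \<partial>lborel) = s * (\<integral>v. ?h (y + s * v) \<partial>lborel)"
    using s by (subst lborel_integral_real_affine[where c=s and t=y]) auto
  also have "\<dots> = (\<integral>v. s * ?h (y + s * v) \<partial>lborel)"
    by simp
  also have "\<dots> = (\<integral>v. max 0 (x - v) * (if v \<in> {0..1} then s\<^sup>2 * f (y + s * v) else 0) \<partial>lborel)"
  proof (rule integral_cong_AE)
    show "AE v in lborel. s * ?h (y + s * v) = max 0 (x - v) * (if v \<in> {0..1} then s\<^sup>2 * f (y + s * v) else 0)"
      using AE_lborel_singleton[of 0]
    proof eventually_elim
      case (elim v)
      have "max 0 (s * x - s * v) = s * max 0 (x - v)"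
        using s by (simp add: max_mult_distrib_left right_diff_distrib)
      then show ?case
        using s x elim by (auto simp: power2_eq_square zero_less_mult_iff)
    qed
  qed measurable
  finally show ?thesis by (simp add: prim2_def algebra_simps)
qed

lemma integrable_restricted_second_diff:
  assumes f: "integrable lborel f"
  shows "integrable lborel (restricted_second_diff f s k)"
proof -
  have "restricted_second_diff f s k = (\<lambda>v. (if v \<in> {0..1} then s\<^sup>2 * f (0 + s * v) else 0)
     - 2 * (if v \<in> {0..1} then s\<^sup>2 * f (k + s * v) else 0) + (if v \<in> {0..1} then s\<^sup>2 * f (2 * k + s * v) else 0))"
    by (auto simp: restricted_second_diff_def second_diff_def algebra_simps fun_eq_iff)
  then show ?thesis
    by (simp only:) (intro Bochner_Integration.integrable_add Bochner_Integration.integrable_diff integrable_mult_right integrable_restricted_affine f)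
qed

lemma second_diff_prim2:
  assumes f: "integrable lborel f" and supp: "\<And>u. u \<notin> {0..1} \<Longrightarrow> f u = 0"
    and s: "0 \<le> s" and x: "x \<in> {0..1}"
  shows "second_diff (prim2 f) k (s * x) = second_diff (prim2 f) k 0 + s * second_diff (prim1 f) k 0 * x + prim2 (restricted_second_diff f s k) x"
proof -
  let ?g = "\<lambda>y v. if v \<in> {0..1} then s\<^sup>2 * f (y + s * v) else 0"
  have gi: "integrable lborel (?g y)" for y by (rule integrable_restricted_affine[OF f])
  have "prim2 (restricted_second_diff f s k) x = prim2 (\<lambda>v. 1 * (1 * ?g 0 v + (-2) * ?g k v) + 1 * ?g (2 * k) v) x"
    by (rule arg_cong[where f="\<lambda>h. prim2 h x"])
       (auto simp: restricted_second_diff_def second_diff_def algebra_simps fun_eq_iff)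
  also have "\<dots> = 1 * prim2 (\<lambda>v. 1 * ?g 0 v + (-2) * ?g k v) x + 1 * prim2 (?g (2 * k)) x"
    by (intro prim2_lincomb Bochner_Integration.integrable_add integrable_mult_right gi) auto
  also have "prim2 (\<lambda>v. 1 * ?g 0 v + (-2) * ?g k v) x = 1 * prim2 (?g 0) x + (-2) * prim2 (?g k) x"
    by (intro prim2_lincomb gi) auto
  finally have e: "prim2 (restricted_second_diff f s k) x = prim2 (?g 0) x - 2 * prim2 (?g k) x + prim2 (?g (2 * k)) x"
    by simp
  have t: "prim2 f (y + s * x) = prim2 f y + s * prim1 f y * x + prim2 (?g y) x" for y
    by (rule prim2_affine[OF f supp s x])
  show ?thesis
    unfolding e using t[of 0] t[of k] t[of "2 * k"]
    by (simp add: second_diff_def algebra_simps)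
qed

text \<open>The second derivative of the Steklov average.\<close>

definition steklov_density :: "real \<Rightarrow> (real \<Rightarrow> real) \<Rightarrow> real \<Rightarrow> real" where
  "steklov_density \<delta> f v = 8 / \<delta>\<^sup>2 * restricted_second_diff f (1 - \<delta>) (\<delta> / 2) v
     + (- 1 / \<delta>\<^sup>2) * restricted_second_diff f (1 - 2 * \<delta>) \<delta> v"

lemma steklov_borel_representation:
  assumes f: "integrable lborel f" and supp: "\<And>u. u \<notin> {0..1} \<Longrightarrow> f u = 0" and \<delta>: "0 < \<delta>" "\<delta> \<le> 1 / 2"
  shows "\<exists>a b. \<forall>x\<in>{0..1}. steklov_borel \<delta> f x = a + b * x + prim2 (steklov_density \<delta> f) x"
proof (intro exI ballI)
  fix x :: real assume x: "x \<in> {0..1}"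
  have 1: "prim2 (steklov_density \<delta> f) x = 8 / \<delta>\<^sup>2 * prim2 (restricted_second_diff f (1 - \<delta>) (\<delta> / 2)) x
     + (- 1 / \<delta>\<^sup>2) * prim2 (restricted_second_diff f (1 - 2 * \<delta>) \<delta>) x"
    unfolding steklov_density_def[abs_def]
    by (intro prim2_lincomb integrable_restricted_second_diff f) (auto simp: restricted_second_diff_def)
  have 2: "second_diff (prim2 f) (\<delta> / 2) ((1 - \<delta>) * x) = second_diff (prim2 f) (\<delta> / 2) 0
      + (1 - \<delta>) * second_diff (prim1 f) (\<delta> / 2) 0 * x + prim2 (restricted_second_diff f (1 - \<delta>) (\<delta> / 2)) x"
    by (rule second_diff_prim2[OF f supp _ x]) (use \<delta> in auto)
  have 3: "second_diff (prim2 f) \<delta> ((1 - 2 * \<delta>) * x) = second_diff (prim2 f) \<delta> 0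
      + (1 - 2 * \<delta>) * second_diff (prim1 f) \<delta> 0 * x + prim2 (restricted_second_diff f (1 - 2 * \<delta>) \<delta>) x"
    by (rule second_diff_prim2[OF f supp _ x]) (use \<delta> in auto)
  have 4: "steklov_borel \<delta> f x = (8 * second_diff (prim2 f) (\<delta> / 2) ((1 - \<delta>) * x)
     - second_diff (prim2 f) \<delta> ((1 - 2 * \<delta>) * x)) / \<delta>\<^sup>2"
    by (rule steklov_borel_prim2[OF f supp \<delta>(1)])
  show "steklov_borel \<delta> f x =
      (8 * second_diff (prim2 f) (\<delta> / 2) 0 - second_diff (prim2 f) \<delta> 0) / \<delta>\<^sup>2
    + ((8 * ((1 - \<delta>) * second_diff (prim1 f) (\<delta> / 2) 0) - (1 - 2 * \<delta>) * second_diff (prim1 f) \<delta> 0) / \<delta>\<^sup>2) * x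
    + prim2 (steklov_density \<delta> f) x"
    unfolding 1 2 3 4 by (simp add: algebra_simps add_divide_distrib diff_divide_distrib)
qed

text \<open>The substitution \<open>y = s v\<close> costs a factor \<open>1 / s\<close> in the \<open>p\<close>-th power of the norm, which the
  factor \<open>s\<^sup>2\<close> absorbs since \<open>p \<ge> 1\<close>. This includes \<open>s = 0\<close>, which occurs for \<open>\<delta> = 1 / 2\<close>.\<close>

lemma restricted_second_diff_Lp_bounded:
  assumes p: "1 \<le> p" and [measurable]: "f \<in> borel_measurable borel"
    and s: "0 \<le> s" "s + 2 * k \<le> 1" "0 < k"
    and w: "Lp_bounded p {0..1 - 2 * k} (second_diff f k) w" "0 \<le> w"
  shows "Lp_bounded p {0..1} (restricted_second_diff f s k) w"
proof (cases "s = 0")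
  case True
  then have "restricted_second_diff f s k = (\<lambda>v. 0)"
    by (auto simp: restricted_second_diff_def)
  then show ?thesis by (simp add: Lp_bounded_def)
next
  case False
  then have s0: "0 < s" using s by simp
  have "(\<integral>\<^sup>+v\<in>{0..1}. ennreal (\<bar>restricted_second_diff f s k v\<bar> powr p) \<partial>lborel)
     = (\<integral>\<^sup>+v. ennreal (s powr (2 * p)) * (ennreal (\<bar>second_diff f k (s * v)\<bar> powr p) * indicator {0..s} (s * v)) \<partial>lborel)"
  proof (rule nn_integral_cong)
    fix v
    have "(s\<^sup>2) powr p = s powr (2 * p)" using s0 by (simp add: powr_powr flip: powr_numeral)
    moreover have "s * v \<in> {0..s} \<longleftrightarrow> v \<in> {0..1}" using s0 by (auto simp: zero_le_mult_iff)
    ultimately show "ennreal (\<bar>restricted_second_diff f s k v\<bar> powr p) * indicator {0..1} v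
      = ennreal (s powr (2 * p)) * (ennreal (\<bar>second_diff f k (s * v)\<bar> powr p) * indicator {0..s} (s * v))"
      by (auto simp: restricted_second_diff_def abs_mult powr_mult ennreal_mult split: split_indicator)
  qed
  also have "\<dots> = ennreal (s powr (2 * p)) * (\<integral>\<^sup>+v. ennreal (\<bar>second_diff f k (s * v)\<bar> powr p) * indicator {0..s} (s * v) \<partial>lborel)"
    by (rule nn_integral_cmult) measurable
  also have "\<dots> = ennreal (s powr (2 * p - 1)) * (ennreal s * (\<integral>\<^sup>+v. ennreal (\<bar>second_diff f k (s * v)\<bar> powr p) * indicator {0..s} (s * v) \<partial>lborel))"
    using s0 by (simp add: powr_diff flip: mult.assoc ennreal_mult)
  also have "ennreal s * (\<integral>\<^sup>+v. ennreal (\<bar>second_diff f k (s * v)\<bar> powr p) * indicator {0..s} (s * v) \<partial>lborel)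
     = (\<integral>\<^sup>+y. ennreal (\<bar>second_diff f k y\<bar> powr p) * indicator {0..s} y \<partial>lborel)"
    using s0 by (subst nn_integral_real_affine[where c=s and t=0]) auto
  also have "\<dots> \<le> (\<integral>\<^sup>+y\<in>{0..1 - 2 * k}. ennreal (\<bar>second_diff f k y\<bar> powr p) \<partial>lborel)"
    using s by (intro nn_integral_mono) (auto split: split_indicator)
  also have "\<dots> \<le> ennreal (w powr p)" using w by (simp add: Lp_bounded_def)
  also have "ennreal (s powr (2 * p - 1)) * ennreal (w powr p) \<le> 1 * ennreal (w powr p)"
  proof (intro mult_right_mono)
    have "s powr (2 * p - 1) \<le> 1" using s0 s p by (intro powr_le1) auto
    then show "ennreal (s powr (2 * p - 1)) \<le> 1" by (simp add: ennreal_le_1)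
  qed simp
  finally show ?thesis by (simp add: Lp_bounded_def mult_left_mono)
qed

lemma steklov_density_Lp_bounded:
  assumes p: "1 \<le> p" and f [measurable]: "f \<in> borel_measurable borel" and \<delta>: "0 < \<delta>" "\<delta> \<le> 1 / 2"
    and w: "\<And>h. 0 < h \<Longrightarrow> h \<le> \<delta> \<Longrightarrow> Lp_bounded p {0..1 - 2 * h} (second_diff f h) w" "0 \<le> w"
  shows "Lp_bounded p {0..1} (steklov_density \<delta> f) (9 / \<delta>\<^sup>2 * w)"
proof -
  have [measurable]: "restricted_second_diff f s k \<in> borel_measurable borel" for s k
    unfolding restricted_second_diff_def[abs_def] by measurable
  have 1: "Lp_bounded p {0..1} (restricted_second_diff f (1 - \<delta>) (\<delta> / 2)) w"
    by (rule restricted_second_diff_Lp_bounded[OF p f]) (use \<delta> w(1)[of "\<delta> / 2"] w(2) in auto)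
  have 2: "Lp_bounded p {0..1} (restricted_second_diff f (1 - 2 * \<delta>) \<delta>) w"
    by (rule restricted_second_diff_Lp_bounded[OF p f]) (use \<delta> w in auto)
  have "Lp_bounded p {0..1} (steklov_density \<delta> f) (\<bar>8 / \<delta>\<^sup>2\<bar> * w + \<bar>- 1 / \<delta>\<^sup>2\<bar> * w)"
    unfolding steklov_density_def[abs_def]
    by (intro Lp_bounded_add p Lp_bounded_cmult 1 2 w) (use w in auto)
  then show ?thesis by (simp add: field_simps)
qed

section \<open>Distance of a function from its Steklov average\<close>

lemma steklov_deviation:
  fixes f :: "real \<Rightarrow> real"
  assumes f: "integrable lborel f" and \<delta>: "0 < \<delta>"
  shows "f x - steklov_borel \<delta> f x = (\<integral>t\<^sub>1. (indicator {0..\<delta>} t\<^sub>1 / \<delta>)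
    * (\<integral>t\<^sub>2. (indicator {0..\<delta>} t\<^sub>2 / \<delta>) * second_diff f ((t\<^sub>1 + t\<^sub>2) / 2 - x * \<delta>) x \<partial>lborel) \<partial>lborel)"
proof -
  let ?\<theta> = "\<lambda>t\<^sub>1 t\<^sub>2. (t\<^sub>1 + t\<^sub>2) / 2 - x * \<delta>"
  define H where "H = (\<lambda>t\<^sub>1. LINT t\<^sub>2:{0..\<delta>}|lborel. 2 * f (x + ?\<theta> t\<^sub>1 t\<^sub>2) - f (x + 2 * ?\<theta> t\<^sub>1 t\<^sub>2))"
  have c: "set_integrable lborel {0..\<delta>} (\<lambda>_. c)" "(LINT t:{0..\<delta>}|lborel. c) = \<delta> * c" for c :: real
    using \<delta> by (auto simp: set_integrable_def set_lebesgue_integral_def emeasure_lborel_Icc_eq)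
  have inner: "(\<integral>t\<^sub>2. (indicator {0..\<delta>} t\<^sub>2 / \<delta>) * second_diff f (?\<theta> t\<^sub>1 t\<^sub>2) x \<partial>lborel) = f x - H t\<^sub>1 / \<delta>" for t\<^sub>1
  proof -
    have "(\<integral>t\<^sub>2. (indicator {0..\<delta>} t\<^sub>2 / \<delta>) * second_diff f (?\<theta> t\<^sub>1 t\<^sub>2) x \<partial>lborel)
      = (\<integral>t\<^sub>2. (indicator {0..\<delta>} t\<^sub>2 *\<^sub>R (f x - (2 * f (x + ?\<theta> t\<^sub>1 t\<^sub>2) - f (x + 2 * ?\<theta> t\<^sub>1 t\<^sub>2)))) / \<delta> \<partial>lborel)"
      by (intro Bochner_Integration.integral_cong) (auto simp: second_diff_def)
    also have "\<dots> = (LINT t\<^sub>2:{0..\<delta>}|lborel. f x - (2 * f (x + ?\<theta> t\<^sub>1 t\<^sub>2) - f (x + 2 * ?\<theta> t\<^sub>1 t\<^sub>2))) / \<delta>"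
      unfolding set_lebesgue_integral_def by (rule integral_divide_zero)
    also have "\<dots> = (\<delta> * f x - H t\<^sub>1) / \<delta>"
      unfolding H_def by (subst set_integral_diff(2)[OF c(1) steklov_inner(2)[OF f \<delta>]]) (simp add: c)
    finally show ?thesis using \<delta> by (simp add: field_simps)
  qed
  have Hi: "set_integrable lborel {0..\<delta>} (\<lambda>t. H t / \<delta>)"
    unfolding H_def by (intro set_integrable_divide steklov_inner_integrable f \<delta>)
  have "(\<integral>t\<^sub>1. (indicator {0..\<delta>} t\<^sub>1 / \<delta>) * (f x - H t\<^sub>1 / \<delta>) \<partial>lborel)
     = (\<integral>t\<^sub>1. (indicator {0..\<delta>} t\<^sub>1 *\<^sub>R (f x - H t\<^sub>1 / \<delta>)) / \<delta> \<partial>lborel)"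
    by (intro Bochner_Integration.integral_cong) auto
  also have "\<dots> = (LINT t\<^sub>1:{0..\<delta>}|lborel. f x - H t\<^sub>1 / \<delta>) / \<delta>"
    unfolding set_lebesgue_integral_def by (rule integral_divide_zero)
  also have "\<dots> = (\<delta> * f x - (LINT t:{0..\<delta>}|lborel. H t) / \<delta>) / \<delta>"
    by (subst set_integral_diff(2)[OF c(1) Hi]) (simp add: c)
  also have "\<dots> = f x - steklov_borel \<delta> f x"
    using \<delta> by (simp add: steklov_borel_def H_def field_simps power2_eq_square)
  finally show ?thesis unfolding inner by simp
qed

lemma nn_integral_average:
  assumes \<delta>: "0 < \<delta>"
  shows "(\<integral>\<^sup>+t. ennreal (indicator {0..\<delta>} t / \<delta>) \<partial>lborel) = ennreal 1"
proof -
  have "(\<integral>\<^sup>+t. ennreal (indicator {0..\<delta>} t / \<delta>) \<partial>lborel) = (\<integral>\<^sup>+t. ennreal (1 / \<delta>) * indicator {0..\<delta>} t \<partial>lborel)"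
    by (intro nn_integral_cong) (auto split: split_indicator)
  also have "\<dots> = ennreal (1 / \<delta>) * ennreal \<delta>"
    using \<delta> by (simp add: nn_integral_cmult_indicator)
  also have "\<dots> = ennreal 1"
    using \<delta> by (simp flip: ennreal_mult)
  finally show ?thesis .
qed

lemma average_powr_le:
  assumes p: "1 \<le> p" and \<delta>: "0 < \<delta>" and [measurable]: "g \<in> borel_measurable borel"
  shows "ennreal (\<bar>\<integral>t. (indicator {0..\<delta>} t / \<delta>) * g t \<partial>lborel\<bar> powr p)
    \<le> (\<integral>\<^sup>+t. ennreal (indicator {0..\<delta>} t / \<delta>) * ennreal (\<bar>g t\<bar> powr p) \<partial>lborel)"
proof -
  have "ennreal (\<bar>\<integral>t. (indicator {0..\<delta>} t / \<delta>) * g t \<partial>lborel\<bar> powr p)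
    \<le> ennreal (1 powr (p - 1)) * (\<integral>\<^sup>+t. ennreal (indicator {0..\<delta>} t / \<delta> * \<bar>g t\<bar> powr p) \<partial>lborel)"
    by (rule kernel_jensen[OF p]) (use \<delta> nn_integral_average[OF \<delta>] in auto)
  also have "\<dots> = (\<integral>\<^sup>+t. ennreal (indicator {0..\<delta>} t / \<delta>) * ennreal (\<bar>g t\<bar> powr p) \<partial>lborel)"
    using \<delta> by (simp add: ennreal_mult flip: times_divide_eq_left)
  finally show ?thesis .
qed

text \<open>Jensen is applied to the inner and to the outer average in turn. The substitution
  \<open>t = (t\<^sub>1 + t\<^sub>2) / 2\<close> has Jacobian \<open>2\<close> and keeps \<open>t\<close> in \<open>[0, \<delta>]\<close>, which makes the bound
  independent of \<open>t\<^sub>1\<close>.\<close>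

lemma steklov_deviation_powr:
  fixes f :: "real \<Rightarrow> real"
  assumes p: "1 \<le> p" and f: "integrable lborel f" and \<delta>: "0 < \<delta>"
  shows "ennreal (\<bar>f x - steklov_borel \<delta> f x\<bar> powr p)
    \<le> ennreal (2 / \<delta>) * (\<integral>\<^sup>+t\<in>{0..\<delta>}. ennreal (\<bar>second_diff f (t - x * \<delta>) x\<bar> powr p) \<partial>lborel)" (is "_ \<le> ?R")
proof -
  have [measurable]: "f \<in> borel_measurable borel" using f by auto
  have [measurable]: "(\<lambda>t. second_diff f (u t) x) \<in> borel_measurable borel" if [measurable]: "u \<in> borel_measurable borel" for u
    unfolding second_diff_def by measurable
  have [measurable]: "(\<lambda>(s, t). second_diff f ((s + t) / 2 - x * \<delta>) x) \<in> borel_measurable (borel \<Otimes>\<^sub>M borel)"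
    unfolding second_diff_def by measurable
  let ?k = "\<lambda>t. indicator {0..\<delta>} t / \<delta>"
  have inner: "ennreal (\<bar>\<integral>t\<^sub>2. ?k t\<^sub>2 * second_diff f ((t\<^sub>1 + t\<^sub>2) / 2 - x * \<delta>) x \<partial>lborel\<bar> powr p) \<le> ?R"
    if t1: "t\<^sub>1 \<in> {0..\<delta>}" for t\<^sub>1
  proof -
    have "ennreal (\<bar>\<integral>t\<^sub>2. ?k t\<^sub>2 * second_diff f ((t\<^sub>1 + t\<^sub>2) / 2 - x * \<delta>) x \<partial>lborel\<bar> powr p)
      \<le> (\<integral>\<^sup>+t\<^sub>2. ennreal (?k t\<^sub>2) * ennreal (\<bar>second_diff f ((t\<^sub>1 + t\<^sub>2) / 2 - x * \<delta>) x\<bar> powr p) \<partial>lborel)"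
      by (rule average_powr_le[OF p \<delta>]) measurable
    also have "\<dots> = ennreal 2 * (\<integral>\<^sup>+t. ennreal (?k (- t\<^sub>1 + 2 * t)) * ennreal (\<bar>second_diff f (t - x * \<delta>) x\<bar> powr p) \<partial>lborel)"
      by (subst nn_integral_real_affine[where c=2 and t="- t\<^sub>1"]) auto
    also have "\<dots> \<le> ennreal 2 * (\<integral>\<^sup>+t. ennreal (1 / \<delta>) * (ennreal (\<bar>second_diff f (t - x * \<delta>) x\<bar> powr p) * indicator {0..\<delta>} t) \<partial>lborel)"
      using t1 \<delta> by (intro mult_left_mono nn_integral_mono) (auto split: split_indicator)
    also have "\<dots> = ennreal 2 * (ennreal (1 / \<delta>) * (\<integral>\<^sup>+t\<in>{0..\<delta>}. ennreal (\<bar>second_diff f (t - x * \<delta>) x\<bar> powr p) \<partial>lborel))"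
      by (subst nn_integral_cmult) auto
    also have "\<dots> = ?R"
    proof -
      have "ennreal 2 * ennreal (1 / \<delta>) = ennreal (2 * (1 / \<delta>))"
        using \<delta> by (intro ennreal_mult[symmetric]) auto
      then show ?thesis
        unfolding mult.assoc[symmetric] by simp
    qed
    finally show ?thesis .
  qed
  have "ennreal (\<bar>f x - steklov_borel \<delta> f x\<bar> powr p)
     \<le> (\<integral>\<^sup>+t\<^sub>1. ennreal (?k t\<^sub>1) * ennreal (\<bar>\<integral>t\<^sub>2. ?k t\<^sub>2 * second_diff f ((t\<^sub>1 + t\<^sub>2) / 2 - x * \<delta>) x \<partial>lborel\<bar> powr p) \<partial>lborel)"
    unfolding steklov_deviation[OF f \<delta>]
    by (rule average_powr_le[OF p \<delta>]) measurable
  also have "\<dots> \<le> (\<integral>\<^sup>+t\<^sub>1. ennreal (?k t\<^sub>1) * ?R \<partial>lborel)"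
  proof (rule nn_integral_mono)
    fix t\<^sub>1
    show "ennreal (?k t\<^sub>1) * ennreal (\<bar>\<integral>t\<^sub>2. ?k t\<^sub>2 * second_diff f ((t\<^sub>1 + t\<^sub>2) / 2 - x * \<delta>) x \<partial>lborel\<bar> powr p)
       \<le> ennreal (?k t\<^sub>1) * ?R"
      using inner[of t\<^sub>1] by (cases "t\<^sub>1 \<in> {0..\<delta>}") (auto intro: mult_left_mono)
  qed
  also have "\<dots> = (\<integral>\<^sup>+t\<^sub>1. ennreal (?k t\<^sub>1) \<partial>lborel) * ?R"
    by (rule nn_integral_multc) measurable
  also have "\<dots> = ?R" unfolding nn_integral_average[OF \<delta>] by simp
  finally show ?thesis .
qed

text \<open>For a fixed step \<open>\<theta> > 0\<close>, the points \<open>x\<close> at which it occurs in the average satisfy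
  \<open>\<theta> \<le> (1 - x) \<delta> \<le> (1 - x) / 2\<close>, so \<open>x + 2 \<theta> \<le> 1\<close> and the modulus of smoothness applies. For
  \<open>\<theta> < 0\<close> one has \<open>x + 2 \<theta> \<ge> 0\<close> in the same way, and the second difference is read from its
  other end.\<close>

lemma second_diff_fibre_bound:
  fixes f :: "real \<Rightarrow> real"
  assumes [measurable]: "f \<in> borel_measurable borel" and \<delta>: "0 < \<delta>" "\<delta> \<le> 1 / 2"
    and w: "\<And>h. 0 < h \<Longrightarrow> h \<le> \<delta> \<Longrightarrow> Lp_bounded p {0..1 - 2 * h} (second_diff f h) w"
  shows "(\<integral>\<^sup>+x. ennreal (\<bar>second_diff f \<theta> x\<bar> powr p) * indicator {x \<in> {0..1}. 0 \<le> x * \<delta> + \<theta> \<and> x * \<delta> + \<theta> \<le> \<delta>} x \<partial>lborel)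
     \<le> ennreal (w powr p) * indicator {- \<delta>..\<delta>} \<theta>" (is "?L \<le> _")
proof -
  have le: "ennreal (\<bar>second_diff f \<theta> x\<bar> powr p) * indicator {x \<in> {0..1}. 0 \<le> x * \<delta> + \<theta> \<and> x * \<delta> + \<theta> \<le> \<delta>} x
     \<le> ennreal (\<bar>second_diff f \<theta> x\<bar> powr p) * indicator A x"
    if "\<And>x. 0 \<le> x \<Longrightarrow> x \<le> 1 \<Longrightarrow> 0 \<le> x * \<delta> + \<theta> \<Longrightarrow> x * \<delta> + \<theta> \<le> \<delta> \<Longrightarrow> x \<in> A" for A x
    using that[of x] by (auto split: split_indicator)
  consider "\<theta> = 0" | "0 < \<theta>" "\<theta> \<le> \<delta>" | "\<theta> < 0" "- \<delta> \<le> \<theta>" | "\<theta> \<notin> {- \<delta>..\<delta>}"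
    by force
  then show ?thesis
  proof cases
    case 1
    then show ?thesis by (simp add: second_diff_def)
  next
    case 2
    have sub: "x \<in> {0..1 - 2 * \<theta>}" if "0 \<le> x" "x \<le> 1" "x * \<delta> + \<theta> \<le> \<delta>" for x
    proof -
      have "\<theta> \<le> (1 - x) * \<delta>" using that by (simp add: algebra_simps)
      also have "\<dots> \<le> (1 - x) * (1 / 2)" using that \<delta> by (intro mult_left_mono) auto
      finally show ?thesis using that by simp
    qed
    have "?L \<le> (\<integral>\<^sup>+x\<in>{0..1 - 2 * \<theta>}. ennreal (\<bar>second_diff f \<theta> x\<bar> powr p) \<partial>lborel)"
      by (intro nn_integral_mono le sub)
    also have "\<dots> \<le> ennreal (w powr p)"
      using w[OF 2] by (simp add: Lp_bounded_def)
    finally show ?thesis using 2 by simp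
  next
    case 3
    have sub: "x \<in> {- 2 * \<theta>..1}" if "0 \<le> x" "x \<le> 1" "0 \<le> x * \<delta> + \<theta>" for x
    proof -
      have "- \<theta> \<le> x * \<delta>" using that by simp
      also have "\<dots> \<le> x * (1 / 2)" using that \<delta> by (intro mult_left_mono) auto
      finally show ?thesis using that by simp
    qed
    have "?L \<le> (\<integral>\<^sup>+x\<in>{- 2 * \<theta>..1}. ennreal (\<bar>second_diff f \<theta> x\<bar> powr p) \<partial>lborel)"
      by (intro nn_integral_mono le sub)
    also have "\<dots> = (\<integral>\<^sup>+y. ennreal (\<bar>second_diff f \<theta> (- 2 * \<theta> + 1 * y)\<bar> powr p) * indicator {- 2 * \<theta>..1} (- 2 * \<theta> + 1 * y) \<partial>lborel)"
      by (subst nn_integral_real_affine[where c=1 and t="- 2 * \<theta>"]) auto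
    also have "\<dots> = (\<integral>\<^sup>+y\<in>{0..1 - 2 * (- \<theta>)}. ennreal (\<bar>second_diff f (- \<theta>) y\<bar> powr p) \<partial>lborel)"
    proof (intro nn_integral_cong)
      fix y
      have "second_diff f \<theta> (- 2 * \<theta> + 1 * y) = second_diff f (- \<theta>) y"
        by (simp add: second_diff_def algebra_simps)
      then show "ennreal (\<bar>second_diff f \<theta> (- 2 * \<theta> + 1 * y)\<bar> powr p) * indicator {- 2 * \<theta>..1} (- 2 * \<theta> + 1 * y)
         = ennreal (\<bar>second_diff f (- \<theta>) y\<bar> powr p) * indicator {0..1 - 2 * (- \<theta>)} y"
        by (auto split: split_indicator)
    qed
    also have "\<dots> \<le> ennreal (w powr p)"
      using w[of "- \<theta>"] 3 by (simp add: Lp_bounded_def)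
    finally show ?thesis using 3 \<delta> by simp
  next
    case 4
    have "x \<in> {}" if x: "0 \<le> x" "x \<le> 1" and "0 \<le> x * \<delta> + \<theta>" "x * \<delta> + \<theta> \<le> \<delta>" for x
    proof -
      have "0 \<le> x * \<delta>" "x * \<delta> \<le> 1 * \<delta>" using x \<delta> by (auto intro!: mult_right_mono)
      then have "- \<delta> \<le> \<theta>" "\<theta> \<le> \<delta>" using that by linarith+
      then show ?thesis using 4 by simp
    qed
    then have "?L \<le> (\<integral>\<^sup>+x\<in>{}. ennreal (\<bar>second_diff f \<theta> x\<bar> powr p) \<partial>lborel)"
      by (intro nn_integral_mono le)
    then show ?thesis by simp
  qed
qed

text \<open>Exchanging the order of integration leaves, for each \<open>\<theta> \<in> [- \<delta>, \<delta>]\<close>, at most \<open>w powr p\<close>.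
  With the density bound \<open>2 / \<delta>\<close> this gives \<open>4 * w powr p\<close>.\<close>

lemma steklov_deviation_Lp_bounded:
  fixes f :: "real \<Rightarrow> real"
  assumes p: "1 \<le> p" and f: "integrable lborel f" and \<delta>: "0 < \<delta>" "\<delta> \<le> 1 / 2"
    and w: "\<And>h. 0 < h \<Longrightarrow> h \<le> \<delta> \<Longrightarrow> Lp_bounded p {0..1 - 2 * h} (second_diff f h) w" "0 \<le> w"
  shows "Lp_bounded p {0..1} (\<lambda>x. f x - steklov_borel \<delta> f x) (4 * w)"
proof -
  have [measurable]: "f \<in> borel_measurable borel" using f by auto
  let ?P = "\<lambda>\<theta> x. ennreal (\<bar>second_diff f \<theta> x\<bar> powr p)"
  let ?I = "\<lambda>\<theta>. indicator {x \<in> {0..1}. 0 \<le> x * \<delta> + \<theta> \<and> x * \<delta> + \<theta> \<le> \<delta>}"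
  have [measurable]: "(\<lambda>x. ?P (u x) (v x)) \<in> borel_measurable M"
    if [measurable]: "u \<in> borel_measurable M" "v \<in> borel_measurable M" for u v and M :: "'z measure"
    unfolding second_diff_def by measurable
  have Im: "(\<lambda>(x, \<theta>). ?I \<theta> x :: ennreal) \<in> borel_measurable (borel \<Otimes>\<^sub>M borel)"
    unfolding indicator_def by measurable
  have "(\<integral>\<^sup>+x\<in>{0..1}. ennreal (\<bar>f x - steklov_borel \<delta> f x\<bar> powr p) \<partial>lborel)
     \<le> (\<integral>\<^sup>+x. ennreal (2 / \<delta>) * (\<integral>\<^sup>+\<theta>. ?P \<theta> x * ?I \<theta> x \<partial>lborel) \<partial>lborel)"
  proof (rule nn_integral_mono)
    fix x
    show "ennreal (\<bar>f x - steklov_borel \<delta> f x\<bar> powr p) * indicator {0..1} x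
      \<le> ennreal (2 / \<delta>) * (\<integral>\<^sup>+\<theta>. ?P \<theta> x * ?I \<theta> x \<partial>lborel)"
    proof (cases "x \<in> {0..1}")
      case True
      have "(\<integral>\<^sup>+t\<in>{0..\<delta>}. ?P (t - x * \<delta>) x \<partial>lborel)
        = (\<integral>\<^sup>+\<theta>. ?P (x * \<delta> + 1 * \<theta> - x * \<delta>) x * indicator {0..\<delta>} (x * \<delta> + 1 * \<theta>) \<partial>lborel)"
        by (subst nn_integral_real_affine[where c=1 and t="x * \<delta>"]) auto
      also have "\<dots> = (\<integral>\<^sup>+\<theta>. ?P \<theta> x * ?I \<theta> x \<partial>lborel)"
        using True by (intro nn_integral_cong) (auto split: split_indicator)
      finally show ?thesis
        using steklov_deviation_powr[OF p f \<delta>(1), of x] True by simp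
    qed simp
  qed
  also have "\<dots> = ennreal (2 / \<delta>) * (\<integral>\<^sup>+x. \<integral>\<^sup>+\<theta>. ?P \<theta> x * ?I \<theta> x \<partial>lborel \<partial>lborel)"
    using Im by (intro nn_integral_cmult) measurable
  also have "(\<integral>\<^sup>+x. \<integral>\<^sup>+\<theta>. ?P \<theta> x * ?I \<theta> x \<partial>lborel \<partial>lborel) = (\<integral>\<^sup>+\<theta>. \<integral>\<^sup>+x. ?P \<theta> x * ?I \<theta> x \<partial>lborel \<partial>lborel)"
    using Im by (intro lborel_pair.Fubini'[symmetric]) measurable
  also have "\<dots> \<le> (\<integral>\<^sup>+\<theta>. ennreal (w powr p) * indicator {- \<delta>..\<delta>} \<theta> \<partial>lborel)"
    by (intro nn_integral_mono second_diff_fibre_bound \<delta> w) measurable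
  also have "\<dots> = ennreal (w powr p) * ennreal (2 * \<delta>)"
    using \<delta> by (simp add: nn_integral_cmult_indicator)
  also have "ennreal (2 / \<delta>) * \<dots> = ennreal (4 * w powr p)"
    using \<delta> by (simp flip: ennreal_mult)
  also have "\<dots> \<le> ennreal ((4 * w) powr p)"
  proof (rule ennreal_leI)
    have "4 powr 1 \<le> 4 powr p" using p by (intro powr_mono) auto
    then show "4 * w powr p \<le> (4 * w) powr p"
      using w by (simp add: powr_mult mult_right_mono)
  qed
  finally show ?thesis by (simp add: Lp_bounded_def mult_left_mono)
qed

section \<open>From Lebesgue to Borel measurable functions\<close>

lemma nn_integral_lebesgue_on:
  assumes "S \<in> sets lebesgue"
  shows "(\<integral>\<^sup>+x. g x \<partial>lebesgue_on S) = (\<integral>\<^sup>+x\<in>S. g x \<partial>lborel)"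
  using assms by (simp add: nn_integral_restrict_space nn_integral_completion)

lemma Lp_norm_nonneg: "0 \<le> Lp_norm p S f"
  by (simp add: Lp_norm_def)

lemma Lp_norm_le:
  assumes p: "1 \<le> p" and S: "S \<in> sets lebesgue" and A: "Lp_bounded p S f0 A" "0 \<le> A"
    and eq: "AE x in lborel. x \<in> S \<longrightarrow> f x = f0 x"
  shows "Lp_norm p S f \<le> A"
proof -
  have "(LINT x|lebesgue_on S. \<bar>f x\<bar> powr p) \<le> A powr p"
  proof (cases "integrable (lebesgue_on S) (\<lambda>x. \<bar>f x\<bar> powr p)")
    case True
    have "ennreal (LINT x|lebesgue_on S. \<bar>f x\<bar> powr p) = (\<integral>\<^sup>+x. ennreal (\<bar>f x\<bar> powr p) \<partial>lebesgue_on S)"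
      using True by (intro nn_integral_eq_integral[symmetric]) auto
    also have "\<dots> = (\<integral>\<^sup>+x\<in>S. ennreal (\<bar>f x\<bar> powr p) \<partial>lborel)"
      by (rule nn_integral_lebesgue_on[OF S])
    also have "\<dots> = (\<integral>\<^sup>+x\<in>S. ennreal (\<bar>f0 x\<bar> powr p) \<partial>lborel)"
      using eq by (intro nn_integral_cong_AE) (auto elim!: eventually_mono split: split_indicator)
    also have "\<dots> \<le> ennreal (A powr p)" using A by (simp add: Lp_bounded_def)
    finally show ?thesis by (simp add: ennreal_le_iff)
  qed (simp add: not_integrable_integral_eq)
  then have "(LINT x|lebesgue_on S. \<bar>f x\<bar> powr p) powr (1 / p) \<le> (A powr p) powr (1 / p)"
    using p by (intro powr_mono2 integral_nonneg_AE) auto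
  then show ?thesis using p A by (simp add: Lp_norm_def powr_powr)
qed

lemma Lp_bounded_Lp_norm:
  assumes p: "1 \<le> p" and S: "S \<in> sets lebesgue"
    and int: "integrable (lebesgue_on S) (\<lambda>x. \<bar>f x\<bar> powr p)"
    and eq: "AE x in lborel. x \<in> S \<longrightarrow> f x = f0 x"
  shows "Lp_bounded p S f0 (Lp_norm p S f)"
proof -
  have "(\<integral>\<^sup>+x\<in>S. ennreal (\<bar>f0 x\<bar> powr p) \<partial>lborel) = (\<integral>\<^sup>+x\<in>S. ennreal (\<bar>f x\<bar> powr p) \<partial>lborel)"
    using eq by (intro nn_integral_cong_AE) (auto elim!: eventually_mono split: split_indicator)
  also have "\<dots> = (\<integral>\<^sup>+x. ennreal (\<bar>f x\<bar> powr p) \<partial>lebesgue_on S)"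
    by (rule nn_integral_lebesgue_on[OF S, symmetric])
  also have "\<dots> = ennreal (LINT x|lebesgue_on S. \<bar>f x\<bar> powr p)"
    using int by (intro nn_integral_eq_integral) auto
  also have "(LINT x|lebesgue_on S. \<bar>f x\<bar> powr p) = Lp_norm p S f powr p"
    using p by (simp add: Lp_norm_def powr_powr integral_nonneg_AE)
  finally show ?thesis by (simp add: Lp_bounded_def)
qed

lemma borel_measurable_lebesgue_AE_cong:
  fixes u v :: "real \<Rightarrow> real"
  assumes v: "v \<in> borel_measurable lebesgue" and eq: "AE x in lborel. u x = v x"
  shows "u \<in> borel_measurable lebesgue"
proof (rule measurableI)
  fix A :: "real set" assume A: "A \<in> sets borel"
  show "u -` A \<inter> space lebesgue \<in> sets lebesgue"
  proof (rule completion.in_sets_AE)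
    show "v -` A \<inter> space lebesgue \<in> sets lebesgue" using v A by (rule measurable_sets)
    show "AE x in lebesgue. (x \<in> v -` A \<inter> space lebesgue) = (x \<in> u -` A \<inter> space lebesgue)"
      using AE_completion[OF eq] by eventually_elim auto
  qed auto
qed simp

lemma integral_lebesgue_AE_eq:
  fixes u v :: "real \<Rightarrow> real"
  assumes [measurable]: "v \<in> borel_measurable borel" and eq: "AE x in lborel. u x = v x"
  shows "integral\<^sup>L lebesgue u = integral\<^sup>L lborel v"
proof -
  have v: "v \<in> borel_measurable lebesgue" by (intro measurable_completion) simp
  have "integral\<^sup>L lebesgue u = integral\<^sup>L lebesgue v"
    by (intro integral_cong_AE borel_measurable_lebesgue_AE_cong[OF v eq] v AE_completion eq)
  then show ?thesis by (simp add: integral_completion)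
qed

lemma set_integral_lebesgue_AE_eq:
  fixes u v :: "real \<Rightarrow> real"
  assumes v: "set_integrable lborel S v" and eq: "AE x in lborel. x \<in> S \<longrightarrow> u x = v x"
  shows "(LINT x:S|lebesgue. u x) = (LINT x:S|lborel. v x)"
  unfolding set_lebesgue_integral_def
proof (rule integral_lebesgue_AE_eq)
  show "(\<lambda>x. indicat_real S x *\<^sub>R v x) \<in> borel_measurable borel"
    using borel_measurable_integrable[OF v[unfolded set_integrable_def]] by simp
  show "AE x in lborel. indicat_real S x *\<^sub>R u x = indicat_real S x *\<^sub>R v x"
    using eq by eventually_elim (auto split: split_indicator)
qed

text \<open>Working with this representative removes the restriction to \<open>[0,1]\<close> from all integrals and
  makes compositions with affine maps of several variables measurable.\<close>

lemma Lp_set_borel_representative: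
  assumes p: "1 \<le> p" and f: "f \<in> Lp_set p {0..1}"
  shows "\<exists>f0. integrable lborel f0 \<and> (\<forall>x. x \<notin> {0..1} \<longrightarrow> f0 x = 0) \<and>
    (AE x in lborel. x \<in> {0..1} \<longrightarrow> f x = f0 x) \<and> integrable lborel (\<lambda>x. \<bar>f0 x\<bar> powr p)"
proof -
  have fm: "f \<in> borel_measurable (lebesgue_on {0..1})"
    and fi: "integrable (lebesgue_on {0..1}) (\<lambda>x. \<bar>f x\<bar> powr p)"
    using f by (auto simp: Lp_set_def)
  have "(\<lambda>x. if x \<in> {0..1} then f x else 0) \<in> borel_measurable lebesgue"
    using fm by (subst borel_measurable_if) auto
  from completion_ex_borel_measurable_real[OF this]
  obtain g where g [measurable]: "g \<in> borel_measurable borel"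
    and eq: "AE x in lborel. (if x \<in> {0..1} then f x else 0) = g x" by auto
  define f0 where "f0 = (\<lambda>x. if x \<in> {0..1} then g x else 0)"
  have m [measurable]: "f0 \<in> borel_measurable borel" unfolding f0_def by measurable
  have f0: "f0 x = 0" if "x \<notin> {0..1}" for x using that by (auto simp: f0_def)
  have ae: "AE x in lborel. x \<in> {0..1} \<longrightarrow> f x = f0 x"
    using eq by eventually_elim (auto simp: f0_def)
  have "Lp_bounded p {0..1} f0 (Lp_norm p {0..1} f)"
    by (rule Lp_bounded_Lp_norm[OF p _ fi ae]) simp
  moreover have "(\<integral>\<^sup>+x. ennreal (\<bar>f0 x\<bar> powr p) \<partial>lborel) = (\<integral>\<^sup>+x\<in>{0..1}. ennreal (\<bar>f0 x\<bar> powr p) \<partial>lborel)"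
    by (intro nn_integral_cong) (auto simp: f0_def split: split_indicator)
  ultimately have ip: "integrable lborel (\<lambda>x. \<bar>f0 x\<bar> powr p)"
    by (intro integrableI_nonneg) (auto simp: Lp_bounded_def intro: le_less_trans)
  have "integrable lborel f0"
  proof (rule Bochner_Integration.integrable_bound)
    show "integrable lborel (\<lambda>x. indicator {0..1::real} x + \<bar>f0 x\<bar> powr p)"
      by (intro Bochner_Integration.integrable_add ip integrable_real_indicator) (auto simp: emeasure_lborel_Icc_eq)
    show "AE x in lborel. norm (f0 x) \<le> norm (indicator {0..1} x + \<bar>f0 x\<bar> powr p)"
    proof (rule AE_I2)
      fix x
      have "\<bar>f0 x\<bar> \<le> 1 + \<bar>f0 x\<bar> powr p"
        by (rule abs_le_one_plus_powr[OF p])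
      then show "norm (f0 x) \<le> norm (indicator {0..1} x + \<bar>f0 x\<bar> powr p)"
        using f0[of x] by (auto split: split_indicator)
    qed
  qed simp
  then show ?thesis
    by (intro exI[of _ f0] conjI allI impI ip ae f0)
qed

lemma abs_continuous_on_subset:
  assumes "abs_continuous_on S f" "T \<subseteq> S"
  shows "abs_continuous_on T f"
  unfolding abs_continuous_on_def
proof (intro allI impI)
  fix e :: real assume "0 < e"
  then obtain d where d: "0 < d" and small: "\<forall>\<D>. \<D> division_of \<Union>\<D> \<and> \<Union>\<D> \<subseteq> S \<and>
      (\<Sum>I\<in>\<D>. (Sup I - Inf I)) < d \<longrightarrow> (\<Sum>I\<in>\<D>. \<bar>f (Sup I) - f (Inf I)\<bar>) < e"
    using assms(1) unfolding abs_continuous_on_def by meson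
  show "\<exists>d>0. \<forall>\<D>. \<D> division_of \<Union>\<D> \<and> \<Union>\<D> \<subseteq> T \<and>
      (\<Sum>I\<in>\<D>. (Sup I - Inf I)) < d \<longrightarrow> (\<Sum>I\<in>\<D>. \<bar>f (Sup I) - f (Inf I)\<bar>) < e"
  proof (intro exI[of _ d] conjI allI impI d)
    fix \<D>
    assume D: "\<D> division_of \<Union>\<D> \<and> \<Union>\<D> \<subseteq> T \<and> (\<Sum>I\<in>\<D>. (Sup I - Inf I)) < d"
    then have "\<Union>\<D> \<subseteq> S" using assms(2) by (meson order_trans)
    then show "(\<Sum>I\<in>\<D>. \<bar>f (Sup I) - f (Inf I)\<bar>) < e"
      using small D by simp
  qed
qed

lemma has_integral_prim1:
  assumes h: "integrable lborel h" and supp: "\<And>u. u \<notin> {0..1} \<Longrightarrow> h u = 0"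
  shows "(h has_integral prim1 h v) {0..v}"
proof -
  have "((\<lambda>u. if u \<le> v then h u else 0) has_integral prim1 h v) UNIV"
    unfolding prim1_def by (intro has_integral_integral_lborel integrable_cut h) simp
  also have "(\<lambda>u. if u \<le> v then h u else 0) = (\<lambda>u. if u \<in> {0..v} then h u else 0)"
    using supp by (auto simp: fun_eq_iff)
  finally show ?thesis by (simp only: has_integral_restrict_UNIV)
qed

text \<open>The derivative is recovered from \<open>h = g''\<close> by the fundamental theorem for absolutely
  continuous functions, and \<open>g\<close> from the derivative, which exists everywhere, by the classical one.\<close>

lemma sobolev_W2_representation:
  assumes p: "1 \<le> p" and g: "g \<in> sobolev_W2 p"
  shows "\<exists>a b h. integrable lborel h \<and> (\<forall>u. u \<notin> {0..1} \<longrightarrow> h u = 0) \<and>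
    (AE x in lborel. x \<in> {0..1} \<longrightarrow> deriv01 (deriv01 g) x = h x) \<and>
    (\<forall>x\<in>{0..1}. g x = a + b * x + prim2 h x)"
proof -
  let ?g' = "deriv01 g"
  let ?g'' = "deriv01 (deriv01 g)"
  have diff: "\<And>x. x \<in> {0..1} \<Longrightarrow> g differentiable (at x within {0..1})"
    and ac: "abs_continuous_on {0..1} ?g'"
    and diff2: "AE x in lebesgue_on {0..1}. ?g' differentiable (at x within {0..1})"
    and Lp: "?g'' \<in> Lp_set p {0..1}"
    using g by (auto simp: sobolev_W2_def)
  obtain h where h: "integrable lborel h" and supp: "\<And>x. x \<notin> {0..1} \<Longrightarrow> h x = 0"
    and ae: "AE x in lborel. x \<in> {0..1} \<longrightarrow> ?g'' x = h x"
    using Lp_set_borel_representative[OF p Lp] by blast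
  have "AE x in lebesgue. x \<in> {0..1} \<longrightarrow> ?g' differentiable (at x within {0..1})"
    using diff2 by (simp add: AE_restrict_space_iff)
  then have "AE x in lebesgue. x \<in> {0..1} \<longrightarrow> ?g' differentiable (at x within {0..1}) \<and> ?g'' x = h x"
    using AE_completion[OF ae] by eventually_elim auto
  then have N: "negligible {x. \<not> (x \<in> {0..1} \<longrightarrow> ?g' differentiable (at x within {0..1}) \<and> ?g'' x = h x)}" (is "negligible ?N")
    by (subst (asm) completion.AE_iff_null_sets) (simp add: negligible_iff_null_sets)
  have g': "?g' v = ?g' 0 + prim1 h v" if v: "v \<in> {0..1}" for v
  proof -
    have "(h has_integral (?g' v - ?g' 0)) {0..v}"
    proof (rule abs_continuous_FTC[OF _ _ N])
      show "abs_continuous_on {0..v} ?g'"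
        by (rule abs_continuous_on_subset[OF ac]) (use v in auto)
      fix x assume x: "x \<in> {0..v} - ?N"
      have x': "x \<in> {0..1}" "?g' differentiable (at x within {0..1})" "?g'' x = h x" using x v by auto
      have "(?g' has_vector_derivative ?g'' x) (at x within {0..1})"
        using iffD1[OF vector_derivative_works x'(2)] by (simp only: deriv01_def[of ?g' x])
      then have "(?g' has_vector_derivative ?g'' x) (at x within {0..v})"
        by (rule has_vector_derivative_within_subset) (use v in auto)
      then show "(?g' has_vector_derivative h x) (at x within {0..v})"
        using x'(3) by simp
    qed (use v in auto)
    then show ?thesis
      using has_integral_unique[OF has_integral_prim1[OF h supp, of v]] by fastforce
  qed
  have rep: "g x = g 0 + ?g' 0 * x + prim2 h x" if x: "x \<in> {0..1}" for x
  proof -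
    have "(?g' has_integral (g x - g 0)) {0..x}"
    proof (rule fundamental_theorem_of_calculus)
      fix v assume v: "v \<in> {0..x}"
      then have "(g has_vector_derivative ?g' v) (at v within {0..1})"
        using iffD1[OF vector_derivative_works diff[of v]] x by (simp add: deriv01_def[of g v])
      then show "(g has_vector_derivative ?g' v) (at v within {0..x})"
        by (rule has_vector_derivative_within_subset) (use x in auto)
    qed (use x in auto)
    moreover have "(?g' has_integral (?g' 0 * x + prim2 h x)) {0..x}"
    proof -
      have si: "set_integrable lborel {0..x} (prim1 h)"
        using set_integrable_prim1_affine[OF h, of x 0 1] by simp
      have "1 * (LINT t:{0..x}|lborel. prim1 h (0 + 1 * t)) = prim2 h (0 + 1 * x) - prim2 h 0"
        by (rule prim2_diff[OF h supp]) (use x in auto)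
      moreover have "max 0 (0 - u) * h u = 0" for u
        using supp[of u] by (cases "u \<in> {0..1}") auto
      then have "prim2 h 0 = 0"
        unfolding prim2_def by (simp only:) simp
      ultimately have "(prim1 h has_integral prim2 h x) {0..x}"
        using set_borel_integral_eq_integral[OF si] by (simp add: has_integral_iff)
      then have "((\<lambda>v. ?g' 0 + prim1 h v) has_integral (x - 0) *\<^sub>R ?g' 0 + prim2 h x) {0..x}"
        using x has_integral_const_real[of "?g' 0" 0 x] by (intro has_integral_add) auto
      then have "(?g' has_integral (x - 0) *\<^sub>R ?g' 0 + prim2 h x) {0..x}"
      proof (rule has_integral_eq[rotated])
        fix v assume "v \<in> {0..x}"
        then have "v \<in> {0..1}" using x by simp
        from g'[OF this] show "?g' 0 + prim1 h v = ?g' v" by (rule sym)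
      qed
      then show ?thesis by (simp add: mult.commute)
    qed
    ultimately have "g x - g 0 = ?g' 0 * x + prim2 h x" by (rule has_integral_unique)
    then show ?thesis by simp
  qed
  show ?thesis
    by (rule exI[of _ "g 0"], rule exI[of _ "?g' 0"], rule exI[of _ h])
       (intro conjI allI ballI impI h ae; (erule supp | erule rep))
qed

text \<open>A version of \<open>AE_borel_affine\<close> for arbitrary predicates, as needed for equality almost
  everywhere with a Lebesgue measurable function.\<close>

lemma AE_lborel_affine:
  fixes P :: "real \<Rightarrow> bool"
  assumes "AE x in lborel. P x" "c \<noteq> 0"
  shows "AE x in lborel. P (t + c * x)"
proof -
  obtain N where N: "{x \<in> space lborel. \<not> P x} \<subseteq> N" "emeasure lborel N = 0" "N \<in> sets lborel"
    using assms(1) by (rule AE_E)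
  have [measurable]: "N \<in> sets borel" using N by simp
  have "AE x in lborel. x \<notin> N"
    using N by (intro AE_not_in) (simp add: null_sets_def)
  then have "AE x in lborel. t + c * x \<notin> N"
    by (intro AE_borel_affine assms) auto
  then show ?thesis by eventually_elim (use N in auto)
qed

lemma Lp_bounded_subset:
  assumes "Lp_bounded p T f A" "S \<subseteq> T"
  shows "Lp_bounded p S f A"
proof -
  have "(\<integral>\<^sup>+x\<in>S. ennreal (\<bar>f x\<bar> powr p) \<partial>lborel) \<le> (\<integral>\<^sup>+x\<in>T. ennreal (\<bar>f x\<bar> powr p) \<partial>lborel)"
    using assms(2) by (intro nn_integral_mono) (auto split: split_indicator)
  then show ?thesis using assms(1) unfolding Lp_bounded_def by order
qed

lemma Lp_bounded_second_diff:
  assumes p: "1 \<le> p" and f: "Lp_bounded p UNIV f A" "0 \<le> A" and [measurable]: "f \<in> borel_measurable borel"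
  shows "Lp_bounded p UNIV (second_diff f h) (4 * A)"
proof -
  have shift: "Lp_bounded p UNIV (\<lambda>x. f (x + c)) A" for c
    using f(1) unfolding Lp_bounded_def
    by (subst (asm) nn_integral_real_affine[where c=1 and t=c]) (auto simp: add.commute)
  have "Lp_bounded p UNIV (\<lambda>x. f (x + 0) + ((-2) * f (x + h) + f (x + 2 * h))) (A + (\<bar>-2\<bar> * A + A))"
    by (intro Lp_bounded_add p Lp_bounded_cmult shift) (use f in auto)
  then show ?thesis by (simp add: second_diff_def[abs_def] algebra_simps)
qed

lemma integrable_lebesgue_on_AE:
  fixes u v :: "real \<Rightarrow> real"
  assumes v: "integrable lborel v" and S [measurable]: "S \<in> sets borel"
    and eq: "AE x in lborel. x \<in> S \<longrightarrow> u x = v x"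
  shows "integrable (lebesgue_on S) u"
proof -
  have [measurable]: "v \<in> borel_measurable borel" using v by auto
  have m: "(\<lambda>x. indicator S x *\<^sub>R v x) \<in> borel_measurable lebesgue"
    by (intro measurable_completion) simp
  have ae: "AE x in lborel. indicator S x *\<^sub>R u x = indicator S x *\<^sub>R v x"
    using eq by eventually_elim (auto split: split_indicator)
  have "integrable lborel (\<lambda>x. indicator S x *\<^sub>R v x)"
    by (intro integrable_mult_indicator v) simp
  then have "integrable lebesgue (\<lambda>x. indicator S x *\<^sub>R v x)"
    by (subst integrable_completion) auto
  then have "integrable lebesgue (\<lambda>x. indicator S x *\<^sub>R u x)"
    by (subst integrable_cong_AE[OF borel_measurable_lebesgue_AE_cong[OF m ae] m AE_completion[OF ae]])
  then show ?thesis by (subst integrable_restrict_space) auto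
qed

text \<open>The supremum that defines \<open>omega2\<close> carries information only if its set is bounded; here
  \<open>4\<close> times the norm of \<open>f\<close> is a bound.\<close>

lemma omega2_Lp_bounded:
  assumes p: "1 \<le> p"
    and f0: "integrable lborel f0" and ip: "integrable lborel (\<lambda>x. \<bar>f0 x\<bar> powr p)"
    and ae: "AE x in lborel. x \<in> {0..1} \<longrightarrow> f x = f0 x"
  shows "0 < h \<Longrightarrow> h \<le> \<delta> \<Longrightarrow> Lp_bounded p {0..1 - 2 * h} (second_diff f0 h) (omega2 p f \<delta>)"
    and "0 < \<delta> \<Longrightarrow> 0 \<le> omega2 p f \<delta>"
proof -
  have [measurable]: "f0 \<in> borel_measurable borel" using f0 by auto
  define A where "A = (\<integral>x. \<bar>f0 x\<bar> powr p \<partial>lborel) powr (1 / p)"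
  let ?D = "\<lambda>h x. f x - 2 * f (x + h) + f (x + 2 * h)"
  have "Lp_bounded p UNIV f0 A"
    using p by (simp add: Lp_bounded_def A_def powr_powr nn_integral_eq_integral[OF ip] integral_nonneg_AE)
  then have B: "Lp_bounded p UNIV (second_diff f0 h) (4 * A)" for h
    by (rule Lp_bounded_second_diff[OF p]) (auto simp: A_def)
  have eq: "AE x in lborel. x \<in> {0..1 - 2 * h} \<longrightarrow> ?D h x = second_diff f0 h x" if "0 < h" for h
    using ae AE_lborel_affine[OF ae, of 1 h, simplified] AE_lborel_affine[OF ae, of 1 "2 * h", simplified]
    by eventually_elim (use that in \<open>auto simp: second_diff_def add.commute\<close>)
  have le: "Lp_norm p {0..1 - 2 * h} (?D h) \<le> 4 * A" if "0 < h" for h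
    by (rule Lp_norm_le[OF p _ Lp_bounded_subset[OF B] _ eq]) (use that in \<open>auto simp: A_def\<close>)
  have bdd: "bdd_above ((\<lambda>h. Lp_norm p {0..1 - 2 * h} (?D h)) ` {0<..\<delta>})"
    using le by (intro bdd_aboveI[of _ "4 * A"]) auto
  have upper: "Lp_norm p {0..1 - 2 * h} (?D h) \<le> omega2 p f \<delta>" if "0 < h" "h \<le> \<delta>" for h
    unfolding omega2_def by (rule cSUP_upper[OF _ bdd]) (use that in auto)
  show "0 \<le> omega2 p f \<delta>" if "0 < \<delta>"
    using upper[of \<delta>] that Lp_norm_nonneg order_trans by blast
  show "Lp_bounded p {0..1 - 2 * h} (second_diff f0 h) (omega2 p f \<delta>)" if h: "0 < h" "h \<le> \<delta>"
  proof (rule Lp_bounded_mono)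
    have "integrable lborel (\<lambda>x. \<bar>second_diff f0 h x\<bar> powr p)"
      using B[of h] by (intro integrableI_nonneg) (auto simp: Lp_bounded_def intro: le_less_trans)
    then have "integrable (lebesgue_on {0..1 - 2 * h}) (\<lambda>x. \<bar>?D h x\<bar> powr p)"
      by (rule integrable_lebesgue_on_AE) (use eq[OF h(1)] in \<open>auto elim!: eventually_mono\<close>)
    then show "Lp_bounded p {0..1 - 2 * h} (second_diff f0 h) (Lp_norm p {0..1 - 2 * h} (?D h))"
      by (rule Lp_bounded_Lp_norm[OF p _ _ eq[OF h(1)], rotated]) simp
  qed (use p upper[OF h] Lp_norm_nonneg in auto)
qed

text \<open>For \<open>x \<in> [0,1]\<close> and \<open>\<delta> \<le> 1 / 2\<close> all arguments lie in \<open>[0,1]\<close>, and they are nonconstant affine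
  functions of \<open>t\<^sub>2\<close>; so the exceptional null set is not seen by any of the inner integrals.\<close>

lemma steklov2_eq_steklov_borel:
  assumes f0: "integrable lborel f0"
    and ae: "AE x in lborel. x \<in> {0..1} \<longrightarrow> f x = f0 x"
    and \<delta>: "0 < \<delta>" "\<delta> \<le> 1 / 2" and x: "x \<in> {0..1}"
  shows "steklov2 \<delta> f x = steklov_borel \<delta> f0 x"
proof -
  let ?\<theta> = "\<lambda>t\<^sub>1 t\<^sub>2. (t\<^sub>1 + t\<^sub>2) / 2 - x * \<delta>"
  have sum: "(\<Sum>m=1..2. (-1) ^ (3 - m) * real (2 choose (2 - m)) * f (x + real m * \<theta>))
      = 2 * f (x + \<theta>) - f (x + 2 * \<theta>)" for \<theta>
    by (simp add: numeral_2_eq_2 numeral_3_eq_3)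
  have inner: "(LINT t\<^sub>2:{0..\<delta>}|lebesgue. 2 * f (x + ?\<theta> t\<^sub>1 t\<^sub>2) - f (x + 2 * ?\<theta> t\<^sub>1 t\<^sub>2))
     = (LINT t\<^sub>2:{0..\<delta>}|lborel. 2 * f0 (x + ?\<theta> t\<^sub>1 t\<^sub>2) - f0 (x + 2 * ?\<theta> t\<^sub>1 t\<^sub>2))"
    if t1: "t\<^sub>1 \<in> {0..\<delta>}" for t\<^sub>1
  proof (rule set_integral_lebesgue_AE_eq[OF steklov_inner(2)[OF f0 \<delta>(1)]])
    have ae1: "AE t in lborel. x + ?\<theta> t\<^sub>1 t \<in> {0..1} \<longrightarrow> f (x + ?\<theta> t\<^sub>1 t) = f0 (x + ?\<theta> t\<^sub>1 t)"
    proof -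
      have "x + ?\<theta> t\<^sub>1 t = (x + t\<^sub>1 / 2 - x * \<delta>) + 1 / 2 * t" for t by (simp add: field_simps)
      then show ?thesis using AE_lborel_affine[OF ae, of "1 / 2" "x + t\<^sub>1 / 2 - x * \<delta>"] by (simp only:)
    qed
    have ae2: "AE t in lborel. x + 2 * ?\<theta> t\<^sub>1 t \<in> {0..1} \<longrightarrow> f (x + 2 * ?\<theta> t\<^sub>1 t) = f0 (x + 2 * ?\<theta> t\<^sub>1 t)"
    proof -
      have "x + 2 * ?\<theta> t\<^sub>1 t = (x + t\<^sub>1 - 2 * x * \<delta>) + 1 * t" for t by (simp add: field_simps)
      then show ?thesis using AE_lborel_affine[OF ae, of 1 "x + t\<^sub>1 - 2 * x * \<delta>"] by (simp only:)
    qed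
    have rng: "x + ?\<theta> t\<^sub>1 t \<in> {0..1}" "x + 2 * ?\<theta> t\<^sub>1 t \<in> {0..1}" if "t \<in> {0..\<delta>}" for t
    proof -
      have "0 \<le> x * (1 - 2 * \<delta>)" "0 \<le> (1 - x) * (1 - 2 * \<delta>)" "0 \<le> x * \<delta>" "0 \<le> (1 - x) * \<delta>"
        using x \<delta> by (auto intro!: mult_nonneg_nonneg)
      then have z: "0 \<le> x - 2 * (x * \<delta>)" "x - 2 * (x * \<delta>) + 2 * \<delta> \<le> 1" "0 \<le> x * \<delta>" "x * \<delta> \<le> \<delta>"
        by (simp_all add: algebra_simps)
      have t: "0 \<le> t\<^sub>1 + t" "t\<^sub>1 + t \<le> 2 * \<delta>" using t1 that by auto
      have x': "0 \<le> x" "x \<le> 1" using x by auto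
      have e1: "x + ?\<theta> t\<^sub>1 t = x - x * \<delta> + (t\<^sub>1 / 2 + t / 2)"
        and e2: "x + 2 * ?\<theta> t\<^sub>1 t = x - 2 * (x * \<delta>) + (t\<^sub>1 + t)"
        by (simp_all add: field_simps)
      have "0 \<le> x - x * \<delta> + (t\<^sub>1 / 2 + t / 2)" "x - x * \<delta> + (t\<^sub>1 / 2 + t / 2) \<le> 1"
        using z t x' by linarith+
      then show "x + ?\<theta> t\<^sub>1 t \<in> {0..1}" unfolding e1 by simp
      have "0 \<le> x - 2 * (x * \<delta>) + (t\<^sub>1 + t)" "x - 2 * (x * \<delta>) + (t\<^sub>1 + t) \<le> 1"
        using z t by linarith+
      then show "x + 2 * ?\<theta> t\<^sub>1 t \<in> {0..1}" unfolding e2 by simp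
    qed
    show "AE t\<^sub>2 in lborel. t\<^sub>2 \<in> {0..\<delta>} \<longrightarrow> 2 * f (x + ?\<theta> t\<^sub>1 t\<^sub>2) - f (x + 2 * ?\<theta> t\<^sub>1 t\<^sub>2)
       = 2 * f0 (x + ?\<theta> t\<^sub>1 t\<^sub>2) - f0 (x + 2 * ?\<theta> t\<^sub>1 t\<^sub>2)"
      using ae1 ae2 by eventually_elim (use rng in metis)
  qed
  show ?thesis
    unfolding steklov2_def steklov_borel_def sum
    by (rule arg_cong[where f="(*) (1 / \<delta>\<^sup>2)"],
        rule set_integral_lebesgue_AE_eq[OF steklov_inner_integrable[OF f0 \<delta>(1)]],
        rule AE_I2, rule impI, rule inner)
qed

section \<open>The error estimates\<close>

lemma bernstein_op_cong:
  assumes "\<And>t. t \<in> {0..1} \<Longrightarrow> f t = g t"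
  shows "bernstein_op n f x = bernstein_op n g x"
  unfolding bernstein_op_def by (intro sum.cong) (auto intro!: assms simp: divide_le_eq)

lemma disc_seminorm_nonneg: "0 \<le> disc_seminorm p n f"
  by (simp add: disc_seminorm_def)

lemma bernstein_approx_sobolev:
  assumes p: "1 \<le> p" and g: "g \<in> sobolev_W2 p" and n: "1 \<le> n"
  shows "Lp_norm p {0..1} (\<lambda>x. g x - bernstein_op n g x) \<le> Lp_norm p {0..1} (deriv01 (deriv01 g)) / real n"
proof -
  obtain a b h where h: "integrable lborel h" and supp: "\<And>u. u \<notin> {0..1} \<Longrightarrow> h u = 0"
    and ae: "AE x in lborel. x \<in> {0..1} \<longrightarrow> deriv01 (deriv01 g) x = h x"
    and rep: "\<And>x. x \<in> {0..1} \<Longrightarrow> g x = a + b * x + prim2 h x"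
    using sobolev_W2_representation[OF p g] by blast
  have "integrable (lebesgue_on {0..1}) (\<lambda>x. \<bar>deriv01 (deriv01 g) x\<bar> powr p)"
    using g by (simp add: sobolev_W2_def Lp_set_def)
  then have "Lp_bounded p {0..1} h (Lp_norm p {0..1} (deriv01 (deriv01 g)))"
    by (rule Lp_bounded_Lp_norm[OF p _ _ ae, rotated]) simp
  then have "Lp_bounded p {0..1} (\<lambda>x. (a + b * x + prim2 h x) - bernstein_op n (\<lambda>t. a + b * t + prim2 h t) x)
      (Lp_norm p {0..1} (deriv01 (deriv01 g)) / real n)"
    using n by (intro bernstein_approx_prim2 p h supp Lp_norm_nonneg) auto
  then show ?thesis
  proof (rule Lp_norm_le[OF p, rotated])
    show "AE x in lborel. x \<in> {0..1} \<longrightarrow> g x - bernstein_op n g x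
       = (a + b * x + prim2 h x) - bernstein_op n (\<lambda>t. a + b * t + prim2 h t) x"
      using bernstein_op_cong[of g "\<lambda>t. a + b * t + prim2 h t", OF rep] rep by auto
  qed (auto simp: Lp_norm_nonneg)
qed

text \<open>The Steklov average is used through \<open>T\<close>, which agrees with it on \<open>[0,1]\<close> and hence at the
  nodes. The middle term has norm at most \<open>9 / \<delta>\<^sup>2 * w / n = 9 * w\<close>.\<close>

lemma bernstein_approx_Lp:
  assumes p: "1 \<le> p" and f: "f \<in> Lp_set p {0..1}" and n: "4 \<le> n"
  shows "Lp_norm p {0..1} (\<lambda>x. f x - bernstein_op n f x)
    \<le> disc_seminorm p n (\<lambda>x. steklov2 (1 / sqrt (real n)) f x - f x) + 13 * omega2 p f (1 / sqrt (real n))"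
proof -
  define \<delta> where "\<delta> = 1 / sqrt (real n)"
  define w where "w = omega2 p f \<delta>"
  define \<phi> where "\<phi> = (\<lambda>x. steklov2 \<delta> f x - f x)"
  have "sqrt 4 \<le> sqrt (real n)" using n by (intro real_sqrt_le_mono) simp
  then have \<delta>: "0 < \<delta>" "\<delta> \<le> 1 / 2" "\<delta>\<^sup>2 = 1 / real n"
    using n by (auto simp: \<delta>_def divide_simps)
  obtain f0 where f0: "integrable lborel f0" and supp: "\<And>x. x \<notin> {0..1} \<Longrightarrow> f0 x = 0"
    and ae: "AE x in lborel. x \<in> {0..1} \<longrightarrow> f x = f0 x" and ip: "integrable lborel (\<lambda>x. \<bar>f0 x\<bar> powr p)"
    using Lp_set_borel_representative[OF p f] by blast
  have [measurable]: "f0 \<in> borel_measurable borel" using f0 by auto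
  have w: "Lp_bounded p {0..1 - 2 * h} (second_diff f0 h) w" if "0 < h" "h \<le> \<delta>" for h
    unfolding w_def by (rule omega2_Lp_bounded(1)[OF p f0 ip ae that])
  have w0: "0 \<le> w" unfolding w_def by (rule omega2_Lp_bounded(2)[OF p f0 ip ae \<delta>(1)])
  define h where "h = steklov_density \<delta> f0"
  have h: "integrable lborel h"
    unfolding h_def steklov_density_def[abs_def]
    by (intro Bochner_Integration.integrable_add integrable_mult_right integrable_restricted_second_diff f0)
  have hsupp: "h u = 0" if "u \<notin> {0..1}" for u
    using that by (auto simp: h_def steklov_density_def restricted_second_diff_def)
  have [measurable]: "h \<in> borel_measurable borel" using h by auto
  obtain a b where ab: "\<And>x. x \<in> {0..1} \<Longrightarrow> steklov_borel \<delta> f0 x = a + b * x + prim2 h x"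
    using steklov_borel_representation[OF f0 supp \<delta>(1,2)] unfolding h_def by auto
  define T where "T = (\<lambda>x. a + b * x + prim2 h x)"
  have [measurable]: "T \<in> borel_measurable borel" unfolding T_def by measurable
  have T: "steklov2 \<delta> f x = T x" "steklov_borel \<delta> f0 x = T x" if "x \<in> {0..1}" for x
    using that steklov2_eq_steklov_borel[OF f0 ae \<delta>(1,2) that] ab by (auto simp: T_def)
  have 1: "Lp_bounded p {0..1} (\<lambda>x. f0 x - T x) (4 * w)"
    by (rule Lp_bounded_le_AE[OF steklov_deviation_Lp_bounded[OF p f0 \<delta>(1,2) w w0]])
       (use T p in auto)
  have "Lp_bounded p {0..1} h (9 / \<delta>\<^sup>2 * w)"
    unfolding h_def by (rule steklov_density_Lp_bounded[OF p _ \<delta>(1,2) w w0]) auto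
  then have "Lp_bounded p {0..1} (\<lambda>x. T x - bernstein_op n T x) (9 / \<delta>\<^sup>2 * w / real n)"
    unfolding T_def by (intro bernstein_approx_prim2 p h hsupp) (use n w0 in auto)
  then have 2: "Lp_bounded p {0..1} (\<lambda>x. T x - bernstein_op n T x) (9 * w)"
    using n by (simp add: \<delta>(3))
  have 3: "Lp_bounded p {0..1} (bernstein_op n \<phi>) (disc_seminorm p n \<phi>)"
    by (rule bernstein_op_Lp_bounded[OF p]) (use n in auto)
  have "Lp_bounded p {0..1} (\<lambda>x. (f0 x - T x) + ((T x - bernstein_op n T x) + bernstein_op n \<phi> x))
     (4 * w + (9 * w + disc_seminorm p n \<phi>))"
    by (intro Lp_bounded_add p 1 2 3) (use w0 disc_seminorm_nonneg in auto)
  then have "Lp_norm p {0..1} (\<lambda>x. f x - bernstein_op n f x) \<le> 4 * w + (9 * w + disc_seminorm p n \<phi>)"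
  proof (rule Lp_norm_le[OF p, rotated])
    have "bernstein_op n \<phi> x = bernstein_op n T x - bernstein_op n f x" for x
    proof -
      have "bernstein_op n \<phi> x = bernstein_op n (\<lambda>t. T t - f t) x"
        by (rule bernstein_op_cong) (simp add: \<phi>_def T)
      then show ?thesis by (simp add: bernstein_op_def left_diff_distrib sum_subtractf)
    qed
    then show "AE x in lborel. x \<in> {0..1} \<longrightarrow> f x - bernstein_op n f x
       = (f0 x - T x) + ((T x - bernstein_op n T x) + bernstein_op n \<phi> x)"
      using ae by (auto elim!: eventually_mono)
  qed (use w0 disc_seminorm_nonneg[of p n \<phi>] in auto)
  then show ?thesis by (simp add: w_def \<phi>_def \<delta>_def)
qed

theorem theorem6p4:
  fixes p :: real
  assumes "1 \<le> p"
  shows "\<exists>K\<^sub>3>0.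
    (\<forall>g\<in>sobolev_W2 p. \<forall>n\<ge>1.
       Lp_norm p {0..1} (\<lambda>x. g x - bernstein_op n g x)
         \<le> K\<^sub>3 * (1 / real n) * Lp_norm p {0..1} (deriv01 (deriv01 g))) \<and>
    (let C\<^sub>1 = K\<^sub>3 + 1 in
       \<forall>f\<in>Lp_set p {0..1}. \<forall>n\<ge>4.
         Lp_norm p {0..1} (\<lambda>x. f x - bernstein_op n f x)
           \<le> disc_seminorm p n (\<lambda>x. steklov2 (1 / sqrt (real n)) f x - f x)
              + C\<^sub>1 * omega2 p f (1 / sqrt (real n)) \<and>
         Lp_norm p {0..1} (\<lambda>x. f x - bernstein_op n f x)
           \<le> C\<^sub>1 * Omega22 p f (1 / sqrt (real n)) n)"
  \<comment> \<open>\<open>K\<^sub>3 = 1\<close> suffices for the first estimate; the second one requires \<open>K\<^sub>3 + 1 \<ge> 13\<close>\<close>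
proof (intro exI[of _ 12] conjI)
  show "\<forall>g\<in>sobolev_W2 p. \<forall>n\<ge>1. Lp_norm p {0..1} (\<lambda>x. g x - bernstein_op n g x)
     \<le> 12 * (1 / real n) * Lp_norm p {0..1} (deriv01 (deriv01 g))"
  proof (intro ballI allI impI)
    fix g and n :: nat assume g: "g \<in> sobolev_W2 p" and n: "1 \<le> n"
    have "Lp_norm p {0..1} (deriv01 (deriv01 g)) / real n \<le> 12 * (1 / real n) * Lp_norm p {0..1} (deriv01 (deriv01 g))"
      using n Lp_norm_nonneg[of p "{0..1}" "deriv01 (deriv01 g)"] by (simp add: divide_simps)
    then show "Lp_norm p {0..1} (\<lambda>x. g x - bernstein_op n g x)
     \<le> 12 * (1 / real n) * Lp_norm p {0..1} (deriv01 (deriv01 g))"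
      using bernstein_approx_sobolev[OF assms g n] by linarith
  qed
  show "let C\<^sub>1 = 12 + 1 in
       \<forall>f\<in>Lp_set p {0..1}. \<forall>n\<ge>4.
         Lp_norm p {0..1} (\<lambda>x. f x - bernstein_op n f x)
           \<le> disc_seminorm p n (\<lambda>x. steklov2 (1 / sqrt (real n)) f x - f x)
              + C\<^sub>1 * omega2 p f (1 / sqrt (real n)) \<and>
         Lp_norm p {0..1} (\<lambda>x. f x - bernstein_op n f x)
           \<le> C\<^sub>1 * Omega22 p f (1 / sqrt (real n)) n"
    unfolding Let_def
  proof (intro ballI allI impI)
    fix f and n :: nat assume f: "f \<in> Lp_set p {0..1}" and n: "4 \<le> n"
    let ?D = "disc_seminorm p n (\<lambda>x. steklov2 (1 / sqrt (real n)) f x - f x)"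
    have "Lp_norm p {0..1} (\<lambda>x. f x - bernstein_op n f x) \<le> ?D + 13 * omega2 p f (1 / sqrt (real n))"
      by (rule bernstein_approx_Lp[OF assms f n])
    then show "Lp_norm p {0..1} (\<lambda>x. f x - bernstein_op n f x) \<le> ?D + (12 + 1) * omega2 p f (1 / sqrt (real n)) \<and>
       Lp_norm p {0..1} (\<lambda>x. f x - bernstein_op n f x) \<le> (12 + 1) * Omega22 p f (1 / sqrt (real n)) n"
      using disc_seminorm_nonneg[of p n "\<lambda>x. steklov2 (1 / sqrt (real n)) f x - f x"]
      by (simp add: Omega22_def)
  qed
qed simp

end
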